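(* Let $\Bbbk$ be a commutative ring of global dimension zero and let $C$ be a $\Bbbk$-coalgebra. The colinear Hattori--Stallings rank $[M]\mapsto \mathrm{tr}^C(\mathrm{id}_M)$ defines a homomorphism of abelian groups \[K_0(\mathrm{CoMod}_C^{\mathrm{fg}})\longrightarrow \mathrm{coHH}_0(C).\]
   Context: $\Bbbk$ is a finite product of fields; $\otimes=\otimes_\Bbbk$. $C=(C,\Delta,\varepsilon)$ is a coassociative counital $\Bbbk$-coalgebra and $\mathrm{coHH}_0(C)=\ker(\Delta-\tau\circ\Delta\colon C\to C\otimes C)$, $\tau$ the swap. $\mathrm{CoMod}_C^{\mathrm{fg}}$ is the category of right $C$-comodules that are finitely generated as $\Bbbk$-modules; $K_0(\mathrm{CoMod}_C^{\mathrm{fg}})$ is the free abelian group on isomorphism classes of such comodules modulo $[M]=[M']+[M'']$ for every short exact sequence $0\to M'\to M\to M''\to 0$ of right $C$-comodules in this category. For such $M$ with coaction $m\mapsto\sum m_{(0)}\otimes m_{(1)}$, a $\Bbbk$-basis $e_1,\dots,e_n$ and dual basis $e_i^*$, and a $C$-colinear $f\colon M\to M$, the colinear Hattori--Stallings trace is $\mathrm{tr}^C(f)=\sum_{i=1}^n\sum e_i^*(f(e_{i(0)}))\,e_{i(1)}\in C$, which lies in $\mathrm{coHH}_0(C)$; the rank of $M$ is $\mathrm{tr}^C(\mathrm{id}_M)$. *)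

theory Defs
  imports "HOL-Algebra.Algebra"
begin

text \<open>K is (isomorphic to) a finite product of fields: there is a finite set E of
nonzero pairwise orthogonal idempotents summing to 1 such that each corner e K is a field
(with unit e).  The empty product (zero ring) is allowed.\<close>

definition fin_prod_fields :: "'k ring \<Rightarrow> bool" where
  "fin_prod_fields K \<longleftrightarrow> cring K \<and>
     (\<exists>E. finite E \<and> E \<subseteq> carrier K \<and>
        (\<forall>e\<in>E. e \<otimes>\<^bsub>K\<^esub> e = e \<and> e \<noteq> \<zero>\<^bsub>K\<^esub> \<and>
            (\<forall>x\<in>carrier K. e \<otimes>\<^bsub>K\<^esub> x \<noteq> \<zero>\<^bsub>K\<^esub> \<longrightarrow>
               (\<exists>y\<in>carrier K. (e \<otimes>\<^bsub>K\<^esub> x) \<otimes>\<^bsub>K\<^esub> y = e))) \<and>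
        (\<forall>e\<in>E. \<forall>e'\<in>E. e \<noteq> e' \<longrightarrow> e \<otimes>\<^bsub>K\<^esub> e' = \<zero>\<^bsub>K\<^esub>) \<and>
        finsum K id E = \<one>\<^bsub>K\<^esub>)"

definition msum :: "('k, 'a) module \<Rightarrow> 'a list \<Rightarrow> 'a" where
  "msum M xs = foldr (\<lambda>x y. x \<oplus>\<^bsub>M\<^esub> y) xs \<zero>\<^bsub>M\<^esub>"

definition lin_map :: "'k ring \<Rightarrow> ('k, 'a) module \<Rightarrow> ('k, 'b) module \<Rightarrow> ('a \<Rightarrow> 'b) \<Rightarrow> bool" where
  "lin_map K M N f \<longleftrightarrow> f \<in> carrier M \<rightarrow> carrier N \<and>
     (\<forall>x\<in>carrier M. \<forall>y\<in>carrier M. f (x \<oplus>\<^bsub>M\<^esub> y) = f x \<oplus>\<^bsub>N\<^esub> f y) \<and>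
     (\<forall>r\<in>carrier K. \<forall>x\<in>carrier M. f (r \<odot>\<^bsub>M\<^esub> x) = r \<odot>\<^bsub>N\<^esub> f x)"

definition lin_functional :: "'k ring \<Rightarrow> ('k, 'a) module \<Rightarrow> ('a \<Rightarrow> 'k) \<Rightarrow> bool" where
  "lin_functional K M \<phi> \<longleftrightarrow> \<phi> \<in> carrier M \<rightarrow> carrier K \<and>
     (\<forall>x\<in>carrier M. \<forall>y\<in>carrier M. \<phi> (x \<oplus>\<^bsub>M\<^esub> y) = \<phi> x \<oplus>\<^bsub>K\<^esub> \<phi> y) \<and>
     (\<forall>r\<in>carrier K. \<forall>x\<in>carrier M. \<phi> (r \<odot>\<^bsub>M\<^esub> x) = r \<otimes>\<^bsub>K\<^esub> \<phi> x)"

definition fin_gen :: "'k ring \<Rightarrow> ('k, 'a) module \<Rightarrow> bool" where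
  "fin_gen K M \<longleftrightarrow> (\<exists>S. finite S \<and> S \<subseteq> carrier M \<and>
     (\<forall>m\<in>carrier M. \<exists>a \<in> S \<rightarrow> carrier K. m = finsum M (\<lambda>s. a s \<odot>\<^bsub>M\<^esub> s) S))"

text \<open>An element of M \<otimes>_K N is represented by a list [(a1,b1),...,(an,bn)] standing for
the formal sum a1\<otimes>b1 + ... + an\<otimes>bn.  tens_eq is the congruence (w.r.t. concatenation)
generated by commutativity and the K-bilinearity relations; the quotient of lists with
entries in the carriers by it is the usual tensor product M \<otimes>_K N.\<close>

inductive tens_eq :: "'k ring \<Rightarrow> ('k, 'a) module \<Rightarrow> ('k, 'b) module \<Rightarrow>
    ('a \<times> 'b) list \<Rightarrow> ('a \<times> 'b) list \<Rightarrow> bool"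
  for K M N where
  refl: "tens_eq K M N xs xs"
| sym: "tens_eq K M N xs ys \<Longrightarrow> tens_eq K M N ys xs"
| trans: "tens_eq K M N xs ys \<Longrightarrow> tens_eq K M N ys zs \<Longrightarrow> tens_eq K M N xs zs"
| app: "tens_eq K M N xs ys \<Longrightarrow> tens_eq K M N (xs @ zs) (ys @ zs)"
| comm: "tens_eq K M N (xs @ ys) (ys @ xs)"
| addL: "\<lbrakk>a \<in> carrier M; a' \<in> carrier M; b \<in> carrier N\<rbrakk> \<Longrightarrow>
     tens_eq K M N [(a \<oplus>\<^bsub>M\<^esub> a', b)] [(a, b), (a', b)]"
| addR: "\<lbrakk>a \<in> carrier M; b \<in> carrier N; b' \<in> carrier N\<rbrakk> \<Longrightarrow>
     tens_eq K M N [(a, b \<oplus>\<^bsub>N\<^esub> b')] [(a, b), (a, b')]"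
| smul: "\<lbrakk>r \<in> carrier K; a \<in> carrier M; b \<in> carrier N\<rbrakk> \<Longrightarrow>
     tens_eq K M N [(r \<odot>\<^bsub>M\<^esub> a, b)] [(a, r \<odot>\<^bsub>N\<^esub> b)]"
| zero: "b \<in> carrier N \<Longrightarrow> tens_eq K M N [(\<zero>\<^bsub>M\<^esub>, b)] []"

inductive tens3_eq :: "'k ring \<Rightarrow> ('k, 'a) module \<Rightarrow> ('k, 'b) module \<Rightarrow> ('k, 'c) module \<Rightarrow>
    ('a \<times> 'b \<times> 'c) list \<Rightarrow> ('a \<times> 'b \<times> 'c) list \<Rightarrow> bool"
  for K M N P where
  refl: "tens3_eq K M N P xs xs"
| sym: "tens3_eq K M N P xs ys \<Longrightarrow> tens3_eq K M N P ys xs"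
| trans: "tens3_eq K M N P xs ys \<Longrightarrow> tens3_eq K M N P ys zs \<Longrightarrow> tens3_eq K M N P xs zs"
| app: "tens3_eq K M N P xs ys \<Longrightarrow> tens3_eq K M N P (xs @ zs) (ys @ zs)"
| comm: "tens3_eq K M N P (xs @ ys) (ys @ xs)"
| add1: "\<lbrakk>a \<in> carrier M; a' \<in> carrier M; b \<in> carrier N; c \<in> carrier P\<rbrakk> \<Longrightarrow>
     tens3_eq K M N P [(a \<oplus>\<^bsub>M\<^esub> a', b, c)] [(a, b, c), (a', b, c)]"
| add2: "\<lbrakk>a \<in> carrier M; b \<in> carrier N; b' \<in> carrier N; c \<in> carrier P\<rbrakk> \<Longrightarrow>
     tens3_eq K M N P [(a, b \<oplus>\<^bsub>N\<^esub> b', c)] [(a, b, c), (a, b', c)]"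
| add3: "\<lbrakk>a \<in> carrier M; b \<in> carrier N; c \<in> carrier P; c' \<in> carrier P\<rbrakk> \<Longrightarrow>
     tens3_eq K M N P [(a, b, c \<oplus>\<^bsub>P\<^esub> c')] [(a, b, c), (a, b, c')]"
| smul12: "\<lbrakk>r \<in> carrier K; a \<in> carrier M; b \<in> carrier N; c \<in> carrier P\<rbrakk> \<Longrightarrow>
     tens3_eq K M N P [(r \<odot>\<^bsub>M\<^esub> a, b, c)] [(a, r \<odot>\<^bsub>N\<^esub> b, c)]"
| smul23: "\<lbrakk>r \<in> carrier K; a \<in> carrier M; b \<in> carrier N; c \<in> carrier P\<rbrakk> \<Longrightarrow>
     tens3_eq K M N P [(a, r \<odot>\<^bsub>N\<^esub> b, c)] [(a, b, r \<odot>\<^bsub>P\<^esub> c)]"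
| zero: "\<lbrakk>b \<in> carrier N; c \<in> carrier P\<rbrakk> \<Longrightarrow> tens3_eq K M N P [(\<zero>\<^bsub>M\<^esub>, b, c)] []"

text \<open>A K-coalgebra (C, \<Delta>, \<epsilon>); \<Delta> c is a representative of the tensor \<Delta>(c) \<in> C \<otimes> C.\<close>

definition coalgebra :: "'k ring \<Rightarrow> ('k, 'c) module \<Rightarrow> ('c \<Rightarrow> ('c \<times> 'c) list) \<Rightarrow> ('c \<Rightarrow> 'k) \<Rightarrow> bool" where
  "coalgebra K C \<Delta> \<epsilon> \<longleftrightarrow> module K C \<and> lin_functional K C \<epsilon> \<and>
     (\<forall>c\<in>carrier C. set (\<Delta> c) \<subseteq> carrier C \<times> carrier C) \<and>
     (\<forall>a\<in>carrier C. \<forall>b\<in>carrier C. tens_eq K C C (\<Delta> (a \<oplus>\<^bsub>C\<^esub> b)) (\<Delta> a @ \<Delta> b)) \<and>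
     (\<forall>r\<in>carrier K. \<forall>a\<in>carrier C.
        tens_eq K C C (\<Delta> (r \<odot>\<^bsub>C\<^esub> a)) (map (\<lambda>(x, y). (r \<odot>\<^bsub>C\<^esub> x, y)) (\<Delta> a))) \<and>
     (\<forall>c\<in>carrier C. tens3_eq K C C C
        (concat (map (\<lambda>(x, y). map (\<lambda>(u, v). (u, v, y)) (\<Delta> x)) (\<Delta> c)))
        (concat (map (\<lambda>(x, y). map (\<lambda>(u, v). (x, u, v)) (\<Delta> y)) (\<Delta> c)))) \<and>
     (\<forall>c\<in>carrier C. msum C (map (\<lambda>(x, y). \<epsilon> x \<odot>\<^bsub>C\<^esub> y) (\<Delta> c)) = c \<and>
                     msum C (map (\<lambda>(x, y). \<epsilon> y \<odot>\<^bsub>C\<^esub> x) (\<Delta> c)) = c)"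

definition coHH0 :: "'k ring \<Rightarrow> ('k, 'c) module \<Rightarrow> ('c \<Rightarrow> ('c \<times> 'c) list) \<Rightarrow> 'c set" where
  "coHH0 K C \<Delta> = {c \<in> carrier C. tens_eq K C C (\<Delta> c) (map (\<lambda>(x, y). (y, x)) (\<Delta> c))}"

text \<open>Right C-comodule (M, \<rho>); \<rho> m is a representative of \<rho>(m) \<in> M \<otimes> C.\<close>

definition comodule :: "'k ring \<Rightarrow> ('k, 'c) module \<Rightarrow> ('c \<Rightarrow> ('c \<times> 'c) list) \<Rightarrow> ('c \<Rightarrow> 'k) \<Rightarrow>
    ('k, 'm) module \<Rightarrow> ('m \<Rightarrow> ('m \<times> 'c) list) \<Rightarrow> bool" where
  "comodule K C \<Delta> \<epsilon> M \<rho> \<longleftrightarrow> module K M \<and>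
     (\<forall>m\<in>carrier M. set (\<rho> m) \<subseteq> carrier M \<times> carrier C) \<and>
     (\<forall>a\<in>carrier M. \<forall>b\<in>carrier M. tens_eq K M C (\<rho> (a \<oplus>\<^bsub>M\<^esub> b)) (\<rho> a @ \<rho> b)) \<and>
     (\<forall>r\<in>carrier K. \<forall>a\<in>carrier M.
        tens_eq K M C (\<rho> (r \<odot>\<^bsub>M\<^esub> a)) (map (\<lambda>(x, y). (r \<odot>\<^bsub>M\<^esub> x, y)) (\<rho> a))) \<and>
     (\<forall>m\<in>carrier M. tens3_eq K M C C
        (concat (map (\<lambda>(x, y). map (\<lambda>(u, v). (u, v, y)) (\<rho> x)) (\<rho> m)))
        (concat (map (\<lambda>(x, y). map (\<lambda>(u, v). (x, u, v)) (\<Delta> y)) (\<rho> m)))) \<and>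
     (\<forall>m\<in>carrier M. msum M (map (\<lambda>(x, y). \<epsilon> y \<odot>\<^bsub>M\<^esub> x) (\<rho> m)) = m)"

definition comod_hom :: "'k ring \<Rightarrow> ('k, 'c) module \<Rightarrow>
    ('k, 'm) module \<Rightarrow> ('m \<Rightarrow> ('m \<times> 'c) list) \<Rightarrow>
    ('k, 'n) module \<Rightarrow> ('n \<Rightarrow> ('n \<times> 'c) list) \<Rightarrow> ('m \<Rightarrow> 'n) \<Rightarrow> bool" where
  "comod_hom K C M \<rho> N \<sigma> f \<longleftrightarrow> lin_map K M N f \<and>
     (\<forall>m\<in>carrier M. tens_eq K N C (\<sigma> (f m)) (map (\<lambda>(x, c). (f x, c)) (\<rho> m)))"

definition comod_iso :: "'k ring \<Rightarrow> ('k, 'c) module \<Rightarrow>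
    ('k, 'm) module \<Rightarrow> ('m \<Rightarrow> ('m \<times> 'c) list) \<Rightarrow>
    ('k, 'n) module \<Rightarrow> ('n \<Rightarrow> ('n \<times> 'c) list) \<Rightarrow> bool" where
  "comod_iso K C M \<rho> N \<sigma> \<longleftrightarrow>
     (\<exists>f. comod_hom K C M \<rho> N \<sigma> f \<and> bij_betw f (carrier M) (carrier N))"

definition comod_ses :: "'k ring \<Rightarrow> ('k, 'c) module \<Rightarrow>
    ('k, 'm) module \<Rightarrow> ('m \<Rightarrow> ('m \<times> 'c) list) \<Rightarrow>
    ('k, 'm) module \<Rightarrow> ('m \<Rightarrow> ('m \<times> 'c) list) \<Rightarrow>
    ('k, 'm) module \<Rightarrow> ('m \<Rightarrow> ('m \<times> 'c) list) \<Rightarrow> bool" where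
  "comod_ses K C M1 \<rho>1 M \<rho> M2 \<rho>2 \<longleftrightarrow>
     (\<exists>i p. comod_hom K C M1 \<rho>1 M \<rho> i \<and> comod_hom K C M \<rho> M2 \<rho>2 p \<and>
        inj_on i (carrier M1) \<and> p ` carrier M = carrier M2 \<and>
        i ` carrier M1 = {m \<in> carrier M. p m = \<zero>\<^bsub>M2\<^esub>})"

definition dual_basis :: "'k ring \<Rightarrow> ('k, 'm) module \<Rightarrow> ('m \<times> ('m \<Rightarrow> 'k)) list \<Rightarrow> bool" where
  "dual_basis K M B \<longleftrightarrow>
     (\<forall>(e, \<phi>)\<in>set B. e \<in> carrier M \<and> lin_functional K M \<phi>) \<and>
     (\<forall>m\<in>carrier M. m = msum M (map (\<lambda>(e, \<phi>). \<phi> m \<odot>\<^bsub>M\<^esub> e) B))"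

definition comod_trace :: "('k, 'c) module \<Rightarrow> ('m \<Rightarrow> ('m \<times> 'c) list) \<Rightarrow>
    ('m \<times> ('m \<Rightarrow> 'k)) list \<Rightarrow> ('m \<Rightarrow> 'm) \<Rightarrow> 'c" where
  "comod_trace C \<rho> B f =
     msum C (concat (map (\<lambda>(e, \<phi>). map (\<lambda>(x, c). \<phi> (f x) \<odot>\<^bsub>C\<^esub> c) (\<rho> e)) B))"

definition comod_rank :: "'k ring \<Rightarrow> ('k, 'c) module \<Rightarrow>
    ('k, 'm) module \<Rightarrow> ('m \<Rightarrow> ('m \<times> 'c) list) \<Rightarrow> 'c" where
  "comod_rank K C M \<rho> = comod_trace C \<rho> (SOME B. dual_basis K M B) id"

text \<open>Comodules are taken with carriers in an arbitrary (universally quantified) type 'm.\<close>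

definition fg_comods :: "'k ring \<Rightarrow> ('k, 'c) module \<Rightarrow> ('c \<Rightarrow> ('c \<times> 'c) list) \<Rightarrow> ('c \<Rightarrow> 'k) \<Rightarrow>
    (('k, 'm) module \<times> ('m \<Rightarrow> ('m \<times> 'c) list)) set" where
  "fg_comods K C \<Delta> \<epsilon> = {(M, \<rho>). comodule K C \<Delta> \<epsilon> M \<rho> \<and> fin_gen K M}"

definition comod_class :: "'k ring \<Rightarrow> ('k, 'c) module \<Rightarrow> ('c \<Rightarrow> ('c \<times> 'c) list) \<Rightarrow> ('c \<Rightarrow> 'k) \<Rightarrow>
    (('k, 'm) module \<times> ('m \<Rightarrow> ('m \<times> 'c) list)) \<Rightarrow>
    (('k, 'm) module \<times> ('m \<Rightarrow> ('m \<times> 'c) list)) set" where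
  "comod_class K C \<Delta> \<epsilon> Ma =
     {Nb \<in> fg_comods K C \<Delta> \<epsilon>. comod_iso K C (fst Ma) (snd Ma) (fst Nb) (snd Nb)}"

definition K0_gens :: "'k ring \<Rightarrow> ('k, 'c) module \<Rightarrow> ('c \<Rightarrow> ('c \<times> 'c) list) \<Rightarrow> ('c \<Rightarrow> 'k) \<Rightarrow>
    (('k, 'm) module \<times> ('m \<Rightarrow> ('m \<times> 'c) list)) set set" where
  "K0_gens K C \<Delta> \<epsilon> = comod_class K C \<Delta> \<epsilon> ` fg_comods K C \<Delta> \<epsilon>"

definition K0_rels :: "'k ring \<Rightarrow> ('k, 'c) module \<Rightarrow> ('c \<Rightarrow> ('c \<times> 'c) list) \<Rightarrow> ('c \<Rightarrow> 'k) \<Rightarrow>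
    ((('k, 'm) module \<times> ('m \<Rightarrow> ('m \<times> 'c) list)) set \<Rightarrow>\<^sub>0 int) set" where
  "K0_rels K C \<Delta> \<epsilon> =
     {frag_of (comod_class K C \<Delta> \<epsilon> (M, \<rho>)) - frag_of (comod_class K C \<Delta> \<epsilon> (M1, \<rho>1))
        - frag_of (comod_class K C \<Delta> \<epsilon> (M2, \<rho>2)) | M \<rho> M1 \<rho>1 M2 \<rho>2.
        (M, \<rho>) \<in> fg_comods K C \<Delta> \<epsilon> \<and> (M1, \<rho>1) \<in> fg_comods K C \<Delta> \<epsilon> \<and>
        (M2, \<rho>2) \<in> fg_comods K C \<Delta> \<epsilon> \<and> comod_ses K C M1 \<rho>1 M \<rho> M2 \<rho>2}"

definition K0 :: "'k ring \<Rightarrow> ('k, 'c) module \<Rightarrow> ('c \<Rightarrow> ('c \<times> 'c) list) \<Rightarrow> ('c \<Rightarrow> 'k) \<Rightarrow>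
    ((('k, 'm) module \<times> ('m \<Rightarrow> ('m \<times> 'c) list)) set \<Rightarrow>\<^sub>0 int) set monoid" where
  "K0 K C \<Delta> \<epsilon> = free_Abelian_group (K0_gens K C \<Delta> \<epsilon>)
      Mod generate (free_Abelian_group (K0_gens K C \<Delta> \<epsilon>)) (K0_rels K C \<Delta> \<epsilon>)"

definition K0_class :: "'k ring \<Rightarrow> ('k, 'c) module \<Rightarrow> ('c \<Rightarrow> ('c \<times> 'c) list) \<Rightarrow> ('c \<Rightarrow> 'k) \<Rightarrow>
    (('k, 'm) module \<times> ('m \<Rightarrow> ('m \<times> 'c) list)) \<Rightarrow>
    ((('k, 'm) module \<times> ('m \<Rightarrow> ('m \<times> 'c) list)) set \<Rightarrow>\<^sub>0 int) set" where
  "K0_class K C \<Delta> \<epsilon> Ma =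
     generate (free_Abelian_group (K0_gens K C \<Delta> \<epsilon>)) (K0_rels K C \<Delta> \<epsilon>)
       #>\<^bsub>free_Abelian_group (K0_gens K C \<Delta> \<epsilon>)\<^esub> frag_of (comod_class K C \<Delta> \<epsilon> Ma)"

end

theory Submission
  imports Defs
begin

text \<open>For a functional \<open>\<phi>\<close> on a comodule consider the matrix coefficient
\<open>m \<mapsto> \<Sum> \<phi>(m\<^sub>0) m\<^sub>1\<close>, a linear map into \<open>C\<close>. The rank is the sum of the diagonal matrix coefficients
of any dual basis, and expanding one dual basis in another shows that the choice does not matter.
Coassociativity reads \<open>\<Delta>(c\<^sub>i\<^sub>j) = \<Sum>\<^sub>k c\<^sub>i\<^sub>k \<otimes> c\<^sub>k\<^sub>j\<close> for these coefficients, so \<open>\<Delta>\<close> of the rank is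
\<open>\<Sum> c\<^sub>i\<^sub>k \<otimes> c\<^sub>k\<^sub>i\<close>, which is symmetric. Over a finite product of fields every finitely generated module has
a finite dual basis; hence short exact sequences split linearly, and gluing the dual bases of the
outer terms makes the coaction block triangular, which gives additivity.\<close>

section \<open>Sums over lists in a module\<close>

text \<open>Comultiplication and coactions return list representatives, so linearity, colinearity
  and coassociativity hold only up to a generated congruence. Equations in \<open>C\<close> come out
  of such a congruence by applying a functional to the first factor and summing, which is why matrix
  coefficients carry the whole argument. The congruence puts no carrier condition on reflexivity,
  rotation and appending, so contraction also needs to know that carrier membership is the same on
  both sides. A finitely generated module over a product of fields need not be free. A dual basis
  here is a projective coordinate system: it reproduces every vector, but
  \<open>\<phi>_i(e_j)\<close> need not be a Kronecker delta and the vectors may be redundant. The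
  rank computations therefore rest on the reproducing formula alone; uniqueness of coordinates is
  used only inside a single corner, to construct linear functionals.\<close>

lemma msum_Nil [simp]: "msum M [] = \<zero>\<^bsub>M\<^esub>"
  and msum_Cons [simp]: "msum M (x # xs) = x \<oplus>\<^bsub>M\<^esub> msum M xs"
  by (simp_all add: msum_def)

lemma msum_closed:
  assumes "module K M" "set xs \<subseteq> carrier M"
  shows "msum M xs \<in> carrier M"
proof -
  interpret module K M by fact
  show ?thesis using assms(2) by (induction xs) auto
qed

lemma msum_append:
  assumes "module K M" "set xs \<subseteq> carrier M" "set ys \<subseteq> carrier M"
  shows "msum M (xs @ ys) = msum M xs \<oplus>\<^bsub>M\<^esub> msum M ys"
proof -
  interpret module K M by fact
  show ?thesis
    using assms(2,3)
    by (induction xs) (auto simp: msum_closed[OF assms(1)] M.a_assoc)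
qed

lemma msum_concat:
  assumes "module K M" "\<And>xs. xs \<in> set xss \<Longrightarrow> set xs \<subseteq> carrier M"
  shows "msum M (concat xss) = msum M (map (msum M) xss)"
  using assms(2)
proof (induction xss)
  case (Cons xs xss)
  have "set (concat xss) \<subseteq> carrier M" using Cons.prems by fastforce
  then show ?case
    using Cons by (simp add: msum_append[OF assms(1)])
qed simp

lemma msum_map_add:
  assumes "module K M" "\<And>x. x \<in> set xs \<Longrightarrow> f x \<in> carrier M" "\<And>x. x \<in> set xs \<Longrightarrow> g x \<in> carrier M"
  shows "msum M (map (\<lambda>x. f x \<oplus>\<^bsub>M\<^esub> g x) xs) = msum M (map f xs) \<oplus>\<^bsub>M\<^esub> msum M (map g xs)"
proof -
  interpret module K M by fact
  have cl: "set (map f ys) \<subseteq> carrier M" "set (map g ys) \<subseteq> carrier M"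
    if "set ys \<subseteq> set xs" for ys using that assms(2,3) by auto
  have "msum M (map (\<lambda>x. f x \<oplus>\<^bsub>M\<^esub> g x) ys) = msum M (map f ys) \<oplus>\<^bsub>M\<^esub> msum M (map g ys)"
    if "set ys \<subseteq> set xs" for ys
    using that
  proof (induction ys)
    case (Cons y ys)
    then have "f y \<in> carrier M" "g y \<in> carrier M"
      "msum M (map f ys) \<in> carrier M" "msum M (map g ys) \<in> carrier M"
      using assms cl[of ys] by (auto intro!: msum_closed)
    with Cons show ?case by (simp add: M.a_ac)
  qed simp
  then show ?thesis by simp
qed

lemma msum_map_zero:
  assumes "module K M"
  shows "msum M (map (\<lambda>x. \<zero>\<^bsub>M\<^esub>) xs) = \<zero>\<^bsub>M\<^esub>"
proof -
  interpret module K M by fact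
  show ?thesis by (induction xs) auto
qed

lemma msum_swap:
  assumes "module K M" "\<And>x y. x \<in> set xs \<Longrightarrow> y \<in> set ys \<Longrightarrow> f x y \<in> carrier M"
  shows "msum M (map (\<lambda>x. msum M (map (\<lambda>y. f x y) ys)) xs)
       = msum M (map (\<lambda>y. msum M (map (\<lambda>x. f x y) xs)) ys)"
  using assms(2)
proof (induction xs)
  case Nil
  then show ?case by (simp add: msum_map_zero[OF assms(1)])
next
  case (Cons x xs)
  have "msum M (map (\<lambda>y. f x y \<oplus>\<^bsub>M\<^esub> msum M (map (\<lambda>x. f x y) xs)) ys)
      = msum M (map (f x) ys) \<oplus>\<^bsub>M\<^esub> msum M (map (\<lambda>y. msum M (map (\<lambda>x. f x y) xs)) ys)"
    using Cons.prems by (intro msum_map_add[OF assms(1)] msum_closed[OF assms(1)]) auto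
  with Cons show ?case by simp
qed

lemma finsum_eq_msum:
  assumes "module K M" "distinct xs" "\<And>x. x \<in> set xs \<Longrightarrow> f x \<in> carrier M"
  shows "finsum M f (set xs) = msum M (map f xs)"
proof -
  interpret module K M by fact
  show ?thesis using assms(2,3) by (induction xs) (auto simp: Pi_def)
qed

section \<open>Linear maps\<close>

lemma lin_map_closed: "lin_map K M N f \<Longrightarrow> x \<in> carrier M \<Longrightarrow> f x \<in> carrier N"
  by (auto simp: lin_map_def)

lemma lin_functional_closed: "lin_functional K M \<phi> \<Longrightarrow> x \<in> carrier M \<Longrightarrow> \<phi> x \<in> carrier K"
  by (auto simp: lin_functional_def)

lemma lin_map_zero:
  assumes "module K M" "module K N" "lin_map K M N f"
  shows "f \<zero>\<^bsub>M\<^esub> = \<zero>\<^bsub>N\<^esub>"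
proof -
  interpret M: module K M by fact
  interpret N: module K N by fact
  have "f (\<zero>\<^bsub>K\<^esub> \<odot>\<^bsub>M\<^esub> \<zero>\<^bsub>M\<^esub>) = \<zero>\<^bsub>K\<^esub> \<odot>\<^bsub>N\<^esub> f \<zero>\<^bsub>M\<^esub>"
    using assms(3) unfolding lin_map_def by blast
  then show ?thesis
    using lin_map_closed[OF assms(3)] by simp
qed

lemma lin_map_msum:
  assumes "module K M" "module K N" "lin_map K M N f" "set xs \<subseteq> carrier M"
  shows "f (msum M xs) = msum N (map f xs)"
  using assms(4)
proof (induction xs)
  case Nil
  then show ?case by (simp add: lin_map_zero[OF assms(1-3)])
next
  case (Cons x xs)
  then have "x \<in> carrier M" "msum M xs \<in> carrier M"
    by (auto intro: msum_closed[OF assms(1)])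
  then show ?case using Cons assms(3) by (simp add: lin_map_def)
qed

lemma lin_map_smult:
  assumes "module K M" "r \<in> carrier K"
  shows "lin_map K M M (\<lambda>x. r \<odot>\<^bsub>M\<^esub> x)"
proof -
  interpret module K M by fact
  have "r \<odot>\<^bsub>M\<^esub> (s \<odot>\<^bsub>M\<^esub> x) = s \<odot>\<^bsub>M\<^esub> (r \<odot>\<^bsub>M\<^esub> x)" if "s \<in> carrier K" "x \<in> carrier M" for s x
    using that assms(2) by (metis smult_assoc1 R.m_comm)
  then show ?thesis
    using assms(2) by (auto simp: lin_map_def smult_r_distr)
qed

lemma lin_map_functional_smult:
  assumes "module K N" "lin_functional K M \<phi>" "c \<in> carrier N"
  shows "lin_map K M N (\<lambda>x. \<phi> x \<odot>\<^bsub>N\<^esub> c)"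
proof -
  interpret module K N by fact
  show ?thesis
    using assms(2,3) by (auto simp: lin_map_def lin_functional_def smult_l_distr smult_assoc1 Pi_def)
qed

lemma lin_functional_comp:
  "lin_map K M N f \<Longrightarrow> lin_functional K N \<phi> \<Longrightarrow> lin_functional K M (\<phi> \<circ> f)"
  unfolding lin_map_def lin_functional_def by (auto simp: Pi_def)

lemma dual_basis_expand:
  "dual_basis K M B \<Longrightarrow> m \<in> carrier M \<Longrightarrow> msum M (map (\<lambda>(e, \<phi>). \<phi> m \<odot>\<^bsub>M\<^esub> e) B) = m"
  unfolding dual_basis_def by metis

lemma dual_basis_mem:
  assumes "dual_basis K M B" "(e, \<phi>) \<in> set B"
  shows "e \<in> carrier M" "lin_functional K M \<phi>"
  using assms by (auto simp: dual_basis_def)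

section \<open>Tensors represented by lists\<close>

text \<open>\<open>app\<close> replaces only the left block; the right block is replaced after
  rotating it to the front with \<open>comm\<close>, and then rotated back.\<close>

lemma tens_eq_append:
  assumes "tens_eq K M N xs xs'" "tens_eq K M N ys ys'"
  shows "tens_eq K M N (xs @ ys) (xs' @ ys')"
  by (meson assms tens_eq.app tens_eq.comm tens_eq.trans)

lemma tens_eq_concat_map:
  assumes "\<And>x. x \<in> set xs \<Longrightarrow> tens_eq K M N (f x) (g x)"
  shows "tens_eq K M N (concat (map f xs)) (concat (map g xs))"
  using assms by (induction xs) (auto intro: tens_eq.refl tens_eq_append)

lemma tens_eq_map:
  assumes "\<And>x. x \<in> set xs \<Longrightarrow> tens_eq K M N [f x] [g x]"
  shows "tens_eq K M N (map f xs) (map g xs)"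
  using tens_eq_concat_map[of xs K M N "\<lambda>x. [f x]" "\<lambda>x. [g x]"] assms by simp

text \<open>The congruence supplies only rotations of two blocks. Rotating \<open>ys\<close> until
  the head of \<open>xs\<close> stands in front leaves two tails with equal multisets, so rotations
  generate all permutations.\<close>

lemma tens_eq_mset:
  assumes "mset xs = mset ys"
  shows "tens_eq K M N xs ys"
  using assms
proof (induction xs arbitrary: ys)
  case Nil
  then show ?case by (simp add: tens_eq.refl)
next
  case (Cons x xs)
  then have "x \<in> set ys" by (metis list.set_intros(1) mset_eq_setD)
  then obtain us vs where ys: "ys = us @ x # vs" by (meson split_list)
  with Cons.prems have "mset xs = mset (vs @ us)" by (simp add: union_commute)
  then have "tens_eq K M N ([x] @ xs) ([x] @ vs @ us)"
    by (intro tens_eq_append tens_eq.refl Cons.IH)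
  moreover have "tens_eq K M N (([x] @ vs) @ us) (us @ [x] @ vs)"
    by (rule tens_eq.comm)
  ultimately show ?case
    unfolding ys by (auto intro: tens_eq.trans)
qed

text \<open>A rectangular array is read by rows or by columns. Combined with
  \<open>tens_eq_mset\<close> this is the interchange of double sums of tensors.\<close>

lemma mset_concat_map_swap:
  "mset (concat (map (\<lambda>x. map (\<lambda>y. f x y) ys) xs)) = mset (concat (map (\<lambda>y. map (\<lambda>x. f x y) xs) ys))"
proof (induction xs)
  case Nil
  have "concat (map (\<lambda>y. []) ys) = []" by (induction ys) auto
  then show ?case by simp
next
  case (Cons x xs)
  have "mset (concat (map (\<lambda>y. f x y # map (\<lambda>x. f x y) xs) zs))
      = mset (map (f x) zs) + mset (concat (map (\<lambda>y. map (\<lambda>x. f x y) xs) zs))" for zs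
    by (induction zs) auto
  with Cons show ?case by simp
qed

text \<open>Each bilinearity generator has both sides in the carriers, and the structural rules only
  rearrange or extend lists. An equivalence is proved so that the case \<open>sym\<close> goes
  through; it hands carrier hypotheses on to the middle list of \<open>trans\<close>.\<close>

lemma tens_eq_carrier_iff:
  assumes "module K M" "module K N" "tens_eq K M N xs ys"
  shows "set xs \<subseteq> carrier M \<times> carrier N \<longleftrightarrow> set ys \<subseteq> carrier M \<times> carrier N"
proof -
  interpret M: module K M by fact
  interpret N: module K N by fact
  show ?thesis using assms(3) by induction auto
qed

lemma tens_eq_msumL:
  assumes "module K M" "module K N" "set xs \<subseteq> carrier M" "b \<in> carrier N"
  shows "tens_eq K M N [(msum M xs, b)] (map (\<lambda>x. (x, b)) xs)"
  using assms(3)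
proof (induction xs)
  case Nil
  then show ?case using assms(4) by (simp add: tens_eq.zero)
next
  case (Cons x xs)
  then have "tens_eq K M N [(x \<oplus>\<^bsub>M\<^esub> msum M xs, b)] ([(x, b)] @ [(msum M xs, b)])"
    using assms msum_closed[OF assms(1)] by (simp add: tens_eq.addL)
  moreover have "tens_eq K M N ([(x, b)] @ [(msum M xs, b)]) ([(x, b)] @ map (\<lambda>x. (x, b)) xs)"
    using Cons by (intro tens_eq_append tens_eq.refl) auto
  ultimately show ?case by (auto intro: tens_eq.trans)
qed

text \<open>Only a zero in the left factor is a generator; the scalar \<open>0\<close> is moved
  across the tensor to reach it.\<close>

lemma tens_eq_zeroR:
  assumes "module K M" "module K N" "a \<in> carrier M"
  shows "tens_eq K M N [(a, \<zero>\<^bsub>N\<^esub>)] []"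
proof -
  interpret M: module K M by fact
  interpret N: module K N by fact
  have "tens_eq K M N [(\<zero>\<^bsub>K\<^esub> \<odot>\<^bsub>M\<^esub> a, \<zero>\<^bsub>N\<^esub>)] [(a, \<zero>\<^bsub>K\<^esub> \<odot>\<^bsub>N\<^esub> \<zero>\<^bsub>N\<^esub>)]"
    using assms by (intro tens_eq.smul) auto
  then have "tens_eq K M N [(\<zero>\<^bsub>M\<^esub>, \<zero>\<^bsub>N\<^esub>)] [(a, \<zero>\<^bsub>N\<^esub>)]" using assms by simp
  then show ?thesis by (meson N.zero_closed tens_eq.sym tens_eq.trans tens_eq.zero)
qed

lemma tens_eq_msumR:
  assumes "module K M" "module K N" "set ys \<subseteq> carrier N" "a \<in> carrier M"
  shows "tens_eq K M N [(a, msum N ys)] (map (\<lambda>y. (a, y)) ys)"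
  using assms(3)
proof (induction ys)
  case Nil
  then show ?case using assms by (simp add: tens_eq_zeroR)
next
  case (Cons y ys)
  then have "tens_eq K M N [(a, y \<oplus>\<^bsub>N\<^esub> msum N ys)] ([(a, y)] @ [(a, msum N ys)])"
    using assms msum_closed[OF assms(2)] by (simp add: tens_eq.addR)
  moreover have "tens_eq K M N ([(a, y)] @ [(a, msum N ys)]) ([(a, y)] @ map (\<lambda>y. (a, y)) ys)"
    using Cons by (intro tens_eq_append tens_eq.refl) auto
  ultimately show ?case by (auto intro: tens_eq.trans)
qed

text \<open>The twist is well defined on tensors: mirroring reverses the direction of
  \<open>smul\<close>, exchanges \<open>addL\<close> with \<open>addR\<close>, and turns
  \<open>zero\<close> into \<open>tens_eq_zeroR\<close>.\<close>

lemma tens_eq_swap: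
  assumes "module K M" "module K N" "tens_eq K M N xs ys"
  shows "tens_eq K N M (map (\<lambda>(x, y). (y, x)) xs) (map (\<lambda>(x, y). (y, x)) ys)"
  using assms(3)
proof induction
  case (trans xs ys zs)
  then show ?case by (blast intro: tens_eq.trans)
next
  case (smul r a b)
  then show ?case by (auto intro: tens_eq.sym tens_eq.smul)
next
  case (zero b)
  then show ?case by (simp add: tens_eq_zeroR[OF assms(2,1)])
qed (auto intro: tens_eq.intros)

text \<open>This is well-definedness of \<open>\<phi> \<otimes> id\<close> followed by the
  identification of \<open>K \<otimes> N\<close> with \<open>N\<close>. Carrier membership enters
  because a sum over a concatenation splits only for entries in the module.\<close>

lemma tens_eq_contract:
  assumes "module K M" "module K N" "lin_functional K M \<phi>"
    and "tens_eq K M N xs ys" "set xs \<subseteq> carrier M \<times> carrier N"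
  shows "msum N (map (\<lambda>(x, c). \<phi> x \<odot>\<^bsub>N\<^esub> c) xs) = msum N (map (\<lambda>(x, c). \<phi> x \<odot>\<^bsub>N\<^esub> c) ys)"
proof -
  interpret M: module K M by fact
  interpret N: module K N by fact
  let ?f = "\<lambda>(x, c). \<phi> x \<odot>\<^bsub>N\<^esub> c"
  note phi = lin_functional_closed[OF assms(3)]
  have cl: "set (map ?f zs) \<subseteq> carrier N" if "set zs \<subseteq> carrier M \<times> carrier N" for zs
    using that phi by auto
  show ?thesis using assms(4,5)
  proof induction
    case (sym xs ys)
    then show ?case using tens_eq_carrier_iff[OF assms(1,2)] by metis
  next
    case (trans xs ys zs)
    then show ?case using tens_eq_carrier_iff[OF assms(1,2)] by metis
  next
    case (app xs ys zs)
    then have "set xs \<subseteq> carrier M \<times> carrier N" "set ys \<subseteq> carrier M \<times> carrier N" "set zs \<subseteq> carrier M \<times> carrier N"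
      using tens_eq_carrier_iff[OF assms(1,2)] by auto
    with app show ?case
      using cl by (simp add: msum_append[OF assms(2)])
  next
    case (comm xs ys)
    then have "set xs \<subseteq> carrier M \<times> carrier N" "set ys \<subseteq> carrier M \<times> carrier N" by auto
    then show ?case
      using cl msum_closed[OF assms(2)] by (simp add: msum_append[OF assms(2)] N.a_comm)
  next
    case (addL a a' b)
    then have "\<phi> (a \<oplus>\<^bsub>M\<^esub> a') = \<phi> a \<oplus>\<^bsub>K\<^esub> \<phi> a'" using assms(3) by (simp add: lin_functional_def)
    with addL phi show ?case by (simp add: N.smult_l_distr)
  next
    case (addR a b b')
    with phi show ?case by (simp add: N.smult_r_distr)
  next
    case (smul r a b)
    then have "\<phi> (r \<odot>\<^bsub>M\<^esub> a) = \<phi> a \<otimes>\<^bsub>K\<^esub> r"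
      using assms(3) phi by (simp add: lin_functional_def M.R.m_comm)
    with smul phi show ?case by (simp add: N.smult_assoc1)
  next
    case (zero b)
    then have "\<phi> (\<zero>\<^bsub>K\<^esub> \<odot>\<^bsub>M\<^esub> \<zero>\<^bsub>M\<^esub>) = \<zero>\<^bsub>K\<^esub> \<otimes>\<^bsub>K\<^esub> \<phi> \<zero>\<^bsub>M\<^esub>"
      using assms(3) unfolding lin_functional_def by blast
    with zero phi[OF M.M.zero_closed] show ?case by simp
  qed simp
qed

text \<open>The map \<open>\<phi> \<otimes> id \<otimes> id\<close> is well defined, with the scalar
  absorbed into the second factor. It is what brings coassociativity, a statement about three
  factors, down to \<open>C \<otimes> C\<close>.\<close>

lemma tens3_eq_contract:
  assumes "module K M" "module K N" "module K P" "lin_functional K M \<phi>"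
    and "tens3_eq K M N P xs ys"
  shows "tens_eq K N P (map (\<lambda>(x, b, c). (\<phi> x \<odot>\<^bsub>N\<^esub> b, c)) xs) (map (\<lambda>(x, b, c). (\<phi> x \<odot>\<^bsub>N\<^esub> b, c)) ys)"
proof -
  interpret M: module K M by fact
  interpret N: module K N by fact
  interpret P: module K P by fact
  note phi = lin_functional_closed[OF assms(4)]
  show ?thesis using assms(5)
  proof induction
    case (trans xs ys zs)
    then show ?case by (blast intro: tens_eq.trans)
  next
    case (add1 a a' b c)
    then have "\<phi> (a \<oplus>\<^bsub>M\<^esub> a') = \<phi> a \<oplus>\<^bsub>K\<^esub> \<phi> a'" using assms(4) by (simp add: lin_functional_def)
    with add1 phi show ?case by (simp add: N.smult_l_distr tens_eq.addL)
  next
    case (add2 a b b' c)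
    with phi show ?case by (simp add: N.smult_r_distr tens_eq.addL)
  next
    case (add3 a b c c')
    with phi show ?case by (simp add: tens_eq.addR)
  next
    case (smul12 r a b c)
    then have "\<phi> (r \<odot>\<^bsub>M\<^esub> a) = \<phi> a \<otimes>\<^bsub>K\<^esub> r"
      using assms(4) phi by (simp add: lin_functional_def M.R.m_comm)
    with smul12 phi show ?case by (simp add: N.smult_assoc1 tens_eq.refl)
  next
    case (smul23 r a b c)
    then have "\<phi> a \<odot>\<^bsub>N\<^esub> (r \<odot>\<^bsub>N\<^esub> b) = r \<odot>\<^bsub>N\<^esub> (\<phi> a \<odot>\<^bsub>N\<^esub> b)"
      using phi by (metis N.smult_assoc1 M.R.m_comm)
    with smul23 phi show ?case by (simp add: tens_eq.smul)
  next
    case (zero b c)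
    then have "\<phi> (\<zero>\<^bsub>K\<^esub> \<odot>\<^bsub>M\<^esub> \<zero>\<^bsub>M\<^esub>) = \<zero>\<^bsub>K\<^esub> \<otimes>\<^bsub>K\<^esub> \<phi> \<zero>\<^bsub>M\<^esub>"
      using assms(4) unfolding lin_functional_def by blast
    with zero phi[OF M.M.zero_closed] show ?case by (simp add: tens_eq.zero)
  qed (auto intro: tens_eq.intros)
qed

section \<open>Matrix coefficients of a comodule\<close>

text \<open>For a genuine basis, \<open>\<phi> = e_i^*\<close> and \<open>m = e_j\<close> give the
  entry \<open>c_ij\<close> of the coaction matrix, where the coaction sends \<open>e_j\<close> to
  the sum of \<open>e_i \<otimes> c_ij\<close>.\<close>

definition mcoeff :: "('k, 'c) module \<Rightarrow> ('m \<Rightarrow> ('m \<times> 'c) list) \<Rightarrow> ('m \<Rightarrow> 'k) \<Rightarrow> 'm \<Rightarrow> 'c" where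
  "mcoeff C \<rho> \<phi> m = msum C (map (\<lambda>(x, c). \<phi> x \<odot>\<^bsub>C\<^esub> c) (\<rho> m))"

lemma coalgebra_module: "coalgebra K C \<Delta> \<epsilon> \<Longrightarrow> module K C"
  by (simp add: coalgebra_def)

lemma comodule_module: "comodule K C \<Delta> \<epsilon> M \<rho> \<Longrightarrow> module K M"
  by (simp add: comodule_def)

lemma comodule_mem:
  assumes "comodule K C \<Delta> \<epsilon> M \<rho>" "m \<in> carrier M" "(x, c) \<in> set (\<rho> m)"
  shows "x \<in> carrier M" "c \<in> carrier C"
  using assms unfolding comodule_def by blast+

lemma mcoeff_terms_closed:
  assumes "module K C" "comodule K C \<Delta> \<epsilon> M \<rho>" "lin_functional K M \<phi>" "m \<in> carrier M"
  shows "set (map (\<lambda>(x, c). \<phi> x \<odot>\<^bsub>C\<^esub> c) (\<rho> m)) \<subseteq> carrier C"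
proof -
  interpret module K C by fact
  show ?thesis
    using comodule_mem[OF assms(2,4)] lin_functional_closed[OF assms(3)] by auto
qed

lemma mcoeff_closed:
  assumes "module K C" "comodule K C \<Delta> \<epsilon> M \<rho>" "lin_functional K M \<phi>" "m \<in> carrier M"
  shows "mcoeff C \<rho> \<phi> m \<in> carrier C"
  unfolding mcoeff_def by (rule msum_closed[OF assms(1) mcoeff_terms_closed[OF assms]])

text \<open>The coaction is linear only up to congruence of representatives; contracting that
  congruence yields honest linearity in \<open>C\<close>.\<close>

lemma lin_map_mcoeff:
  assumes C: "module K C" and M: "comodule K C \<Delta> \<epsilon> M \<rho>" and \<phi>: "lin_functional K M \<phi>"
  shows "lin_map K M C (mcoeff C \<rho> \<phi>)"
proof -
  interpret C: module K C by fact
  interpret M: module K M using comodule_module[OF M] .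
  note contract = tens_eq_contract[OF M.module_axioms C \<phi>]
  have \<rho>: "set (\<rho> x) \<subseteq> carrier M \<times> carrier C" if "x \<in> carrier M" for x
    using that M by (simp add: comodule_def)
  have add: "mcoeff C \<rho> \<phi> (x \<oplus>\<^bsub>M\<^esub> y) = mcoeff C \<rho> \<phi> x \<oplus>\<^bsub>C\<^esub> mcoeff C \<rho> \<phi> y"
    if xy: "x \<in> carrier M" "y \<in> carrier M" for x y
  proof -
    have "tens_eq K M C (\<rho> (x \<oplus>\<^bsub>M\<^esub> y)) (\<rho> x @ \<rho> y)"
      using that M by (simp add: comodule_def)
    from contract[OF this] that \<rho>
    have "mcoeff C \<rho> \<phi> (x \<oplus>\<^bsub>M\<^esub> y) = msum C (map (\<lambda>(x, c). \<phi> x \<odot>\<^bsub>C\<^esub> c) (\<rho> x @ \<rho> y))"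
      by (simp add: mcoeff_def)
    also have "\<dots> = mcoeff C \<rho> \<phi> x \<oplus>\<^bsub>C\<^esub> mcoeff C \<rho> \<phi> y"
      unfolding mcoeff_def map_append
      by (rule msum_append[OF C]) (rule mcoeff_terms_closed[OF C M \<phi>], fact)+
    finally show ?thesis .
  qed
  have smult: "mcoeff C \<rho> \<phi> (r \<odot>\<^bsub>M\<^esub> x) = r \<odot>\<^bsub>C\<^esub> mcoeff C \<rho> \<phi> x"
    if r: "r \<in> carrier K" and x: "x \<in> carrier M" for r x
  proof -
    have "tens_eq K M C (\<rho> (r \<odot>\<^bsub>M\<^esub> x)) (map (\<lambda>(x, y). (r \<odot>\<^bsub>M\<^esub> x, y)) (\<rho> x))"
      using that M by (simp add: comodule_def)
    from contract[OF this] that \<rho>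
    have "mcoeff C \<rho> \<phi> (r \<odot>\<^bsub>M\<^esub> x)
        = msum C (map (\<lambda>(x, c). \<phi> x \<odot>\<^bsub>C\<^esub> c) (map (\<lambda>(x, y). (r \<odot>\<^bsub>M\<^esub> x, y)) (\<rho> x)))"
      by (simp add: mcoeff_def)
    also have "map (\<lambda>(x, c). \<phi> x \<odot>\<^bsub>C\<^esub> c) (map (\<lambda>(x, y). (r \<odot>\<^bsub>M\<^esub> x, y)) (\<rho> x))
        = map (\<lambda>c. r \<odot>\<^bsub>C\<^esub> c) (map (\<lambda>(x, c). \<phi> x \<odot>\<^bsub>C\<^esub> c) (\<rho> x))"
      using comodule_mem[OF M x] lin_functional_closed[OF \<phi>] \<phi> r
      by (auto simp: lin_functional_def C.smult_assoc1)
    also have "msum C \<dots> = r \<odot>\<^bsub>C\<^esub> mcoeff C \<rho> \<phi> x"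
      unfolding mcoeff_def
      using lin_map_msum[OF C C lin_map_smult[OF C r] mcoeff_terms_closed[OF C M \<phi> x]] by simp
    finally show ?thesis .
  qed
  show ?thesis
    using add smult mcoeff_closed[OF C M \<phi>] by (auto simp: lin_map_def)
qed

lemma mcoeff_expand_vector:
  assumes C: "module K C" and M: "comodule K C \<Delta> \<epsilon> M \<rho>" and \<phi>: "lin_functional K M \<phi>"
    and B: "dual_basis K M B" and m: "m \<in> carrier M"
  shows "mcoeff C \<rho> \<phi> m = msum C (map (\<lambda>(e, \<psi>). \<psi> m \<odot>\<^bsub>C\<^esub> mcoeff C \<rho> \<phi> e) B)"
proof -
  interpret M: module K M using comodule_module[OF M] .
  note lin = lin_map_mcoeff[OF C M \<phi>]
  have cl: "e \<in> carrier M \<and> \<psi> m \<in> carrier K" if "(e, \<psi>) \<in> set B" for e \<psi>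
    using dual_basis_mem[OF B that] m by (simp add: lin_functional_closed)
  have "mcoeff C \<rho> \<phi> m = mcoeff C \<rho> \<phi> (msum M (map (\<lambda>(e, \<psi>). \<psi> m \<odot>\<^bsub>M\<^esub> e) B))"
    by (simp add: dual_basis_expand[OF B m])
  also have "\<dots> = msum C (map (mcoeff C \<rho> \<phi>) (map (\<lambda>(e, \<psi>). \<psi> m \<odot>\<^bsub>M\<^esub> e) B))"
    using cl by (intro lin_map_msum[OF M.module_axioms C lin]) auto
  also have "map (mcoeff C \<rho> \<phi>) (map (\<lambda>(e, \<psi>). \<psi> m \<odot>\<^bsub>M\<^esub> e) B)
      = map (\<lambda>(e, \<psi>). \<psi> m \<odot>\<^bsub>C\<^esub> mcoeff C \<rho> \<phi> e) B"
    using cl lin by (auto simp: lin_map_def)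
  finally show ?thesis .
qed

text \<open>Dual to the expansion of the vector: reproducing the first tensor legs \<open>x\<close>
  of \<open>\<rho> m\<close> amounts to writing \<open>\<phi>\<close> as the sum of the
  \<open>\<phi>(e) \<psi>\<close>. The sums over \<open>B\<close> and over \<open>\<rho> m\<close>
  are then exchanged.\<close>

lemma mcoeff_expand_functional:
  assumes C: "module K C" and M: "comodule K C \<Delta> \<epsilon> M \<rho>" and \<phi>: "lin_functional K M \<phi>"
    and B: "dual_basis K M B" and m: "m \<in> carrier M"
  shows "mcoeff C \<rho> \<phi> m = msum C (map (\<lambda>(e, \<psi>). \<phi> e \<odot>\<^bsub>C\<^esub> mcoeff C \<rho> \<psi> m) B)"
proof -
  interpret C: module K C by fact
  interpret M: module K M using comodule_module[OF M] .
  note \<phi>_cl = lin_functional_closed[OF \<phi>]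
  have B_cl: "e \<in> carrier M" "\<And>x. x \<in> carrier M \<Longrightarrow> \<psi> x \<in> carrier K" if "(e, \<psi>) \<in> set B" for e \<psi>
    using dual_basis_mem[OF B that] by (auto simp: lin_functional_closed)
  note \<rho>_cl = comodule_mem[OF M m]
  have *: "\<phi> x \<odot>\<^bsub>C\<^esub> c = msum C (map (\<lambda>(e, \<psi>). \<phi> e \<odot>\<^bsub>C\<^esub> (\<psi> x \<odot>\<^bsub>C\<^esub> c)) B)"
    if "(x, c) \<in> set (\<rho> m)" for x c
  proof -
    note xc = \<rho>_cl[OF that]
    have "\<phi> x \<odot>\<^bsub>C\<^esub> c = \<phi> (msum M (map (\<lambda>(e, \<psi>). \<psi> x \<odot>\<^bsub>M\<^esub> e) B)) \<odot>\<^bsub>C\<^esub> c"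
      by (simp add: dual_basis_expand[OF B xc(1)])
    also have "\<dots> = msum C (map (\<lambda>x. \<phi> x \<odot>\<^bsub>C\<^esub> c) (map (\<lambda>(e, \<psi>). \<psi> x \<odot>\<^bsub>M\<^esub> e) B))"
      using B_cl xc by (intro lin_map_msum[OF M.module_axioms C lin_map_functional_smult[OF C \<phi> xc(2)]]) auto
    also have "map (\<lambda>x. \<phi> x \<odot>\<^bsub>C\<^esub> c) (map (\<lambda>(e, \<psi>). \<psi> x \<odot>\<^bsub>M\<^esub> e) B)
        = map (\<lambda>(e, \<psi>). \<phi> e \<odot>\<^bsub>C\<^esub> (\<psi> x \<odot>\<^bsub>C\<^esub> c)) B"
    proof (subst map_map, rule map_cong[OF HOL.refl], clarsimp)
      fix e \<psi> assume e: "(e, \<psi>) \<in> set B"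
      then have "\<phi> (\<psi> x \<odot>\<^bsub>M\<^esub> e) = \<phi> e \<otimes>\<^bsub>K\<^esub> \<psi> x"
        using \<phi> B_cl[OF e] xc \<phi>_cl by (simp add: lin_functional_def C.R.m_comm)
      then show "\<phi> (\<psi> x \<odot>\<^bsub>M\<^esub> e) \<odot>\<^bsub>C\<^esub> c = \<phi> e \<odot>\<^bsub>C\<^esub> (\<psi> x \<odot>\<^bsub>C\<^esub> c)"
        using B_cl[OF e] xc \<phi>_cl by (simp add: C.smult_assoc1)
    qed
    finally show ?thesis .
  qed
  have "mcoeff C \<rho> \<phi> m
      = msum C (map (\<lambda>p. msum C (map (\<lambda>q. \<phi> (fst q) \<odot>\<^bsub>C\<^esub> (snd q (fst p) \<odot>\<^bsub>C\<^esub> snd p)) B)) (\<rho> m))"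
    unfolding mcoeff_def using * by (intro arg_cong[of _ _ "msum C"] map_cong) (auto simp: case_prod_unfold)
  also have "\<dots> = msum C (map (\<lambda>q. msum C (map (\<lambda>p. \<phi> (fst q) \<odot>\<^bsub>C\<^esub> (snd q (fst p) \<odot>\<^bsub>C\<^esub> snd p)) (\<rho> m))) B)"
    using B_cl \<rho>_cl \<phi>_cl by (intro msum_swap[OF C] C.smult_closed) auto
  also have "\<dots> = msum C (map (\<lambda>(e, \<psi>). \<phi> e \<odot>\<^bsub>C\<^esub> mcoeff C \<rho> \<psi> m) B)"
  proof (intro arg_cong[of _ _ "msum C"] map_cong HOL.refl, clarsimp)
    fix e \<psi> assume e: "(e, \<psi>) \<in> set B"
    note mem = dual_basis_mem[OF B e]
    show "msum C (map (\<lambda>p. \<phi> e \<odot>\<^bsub>C\<^esub> (\<psi> (fst p) \<odot>\<^bsub>C\<^esub> snd p)) (\<rho> m)) = \<phi> e \<odot>\<^bsub>C\<^esub> mcoeff C \<rho> \<psi> m"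
      using lin_map_msum[OF C C lin_map_smult[OF C \<phi>_cl[OF mem(1)]] mcoeff_terms_closed[OF C M mem(2) m]]
      by (simp add: mcoeff_def case_prod_unfold comp_def)
  qed
  finally show ?thesis .
qed

text \<open>Contracting the colinearity congruence pulls coefficients back along \<open>f\<close>.
  This is the form in which isomorphism invariance and additivity use colinearity.\<close>

lemma comod_hom_mcoeff:
  assumes C: "module K C" and N: "comodule K C \<Delta> \<epsilon> N \<sigma>"
    and f: "comod_hom K C M \<rho> N \<sigma> f" and \<phi>: "lin_functional K N \<phi>" and m: "m \<in> carrier M"
  shows "mcoeff C \<sigma> \<phi> (f m) = mcoeff C \<rho> (\<phi> \<circ> f) m"
proof -
  have fm: "f m \<in> carrier N" "tens_eq K N C (\<sigma> (f m)) (map (\<lambda>(x, c). (f x, c)) (\<rho> m))"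
    using f m by (auto simp: comod_hom_def lin_map_def)
  then have "set (\<sigma> (f m)) \<subseteq> carrier N \<times> carrier C"
    using N by (simp add: comodule_def)
  from tens_eq_contract[OF comodule_module[OF N] C \<phi> fm(2) this] show ?thesis
    by (simp add: mcoeff_def case_prod_unfold comp_def)
qed

section \<open>The rank\<close>

lemma comod_trace_id:
  assumes C: "module K C" and M: "comodule K C \<Delta> \<epsilon> M \<rho>" and B: "dual_basis K M B"
  shows "comod_trace C \<rho> B id = msum C (map (\<lambda>(e, \<phi>). mcoeff C \<rho> \<phi> e) B)"
proof -
  have "comod_trace C \<rho> B id
      = msum C (map (msum C) (map (\<lambda>(e, \<phi>). map (\<lambda>(x, c). \<phi> x \<odot>\<^bsub>C\<^esub> c) (\<rho> e)) B))"
    unfolding comod_trace_def id_apply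
  proof (rule msum_concat[OF C])
    fix xs assume "xs \<in> set (map (\<lambda>(e, \<phi>). map (\<lambda>(x, c). \<phi> x \<odot>\<^bsub>C\<^esub> c) (\<rho> e)) B)"
    then obtain e \<phi> where e: "(e, \<phi>) \<in> set B" "xs = map (\<lambda>(x, c). \<phi> x \<odot>\<^bsub>C\<^esub> c) (\<rho> e)" by auto
    show "set xs \<subseteq> carrier C"
      unfolding e(2) by (intro mcoeff_terms_closed[OF C M] dual_basis_mem[OF B e(1)])
  qed
  then show ?thesis
    by (simp add: mcoeff_def comp_def case_prod_unfold)
qed

lemma comod_trace_basis_indep:
  assumes C: "module K C" and M: "comodule K C \<Delta> \<epsilon> M \<rho>"
    and B: "dual_basis K M B" and B': "dual_basis K M B'"
  shows "comod_trace C \<rho> B id = comod_trace C \<rho> B' id"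
proof -
  interpret C: module K C by fact
  note mem = dual_basis_mem[OF B] and mem' = dual_basis_mem[OF B']
  \<comment> \<open>With \<open>(e_p, \<phi>_p)\<close> from \<open>B\<close> and
    \<open>(f_q, \<psi>_q)\<close> from \<open>B'\<close>, both traces are sums over the array with
    entries \<open>\<phi>_p(f_q)\<close> times the coefficient of \<open>\<psi>_q\<close> at
    \<open>e_p\<close>. A row expands the functional \<open>\<phi>_p\<close>, a column expands the
    vector \<open>f_q\<close>.\<close>
  have "msum C (map (\<lambda>(e, \<phi>). mcoeff C \<rho> \<phi> e) B)
      = msum C (map (\<lambda>p. msum C (map (\<lambda>q. snd p (fst q) \<odot>\<^bsub>C\<^esub> mcoeff C \<rho> (snd q) (fst p)) B')) B)"
    using mcoeff_expand_functional[OF C M mem(2) B' mem(1)]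
    by (intro arg_cong[of _ _ "msum C"] map_cong) (auto simp: case_prod_unfold)
  also have "\<dots> = msum C (map (\<lambda>q. msum C (map (\<lambda>p. snd p (fst q) \<odot>\<^bsub>C\<^esub> mcoeff C \<rho> (snd q) (fst p)) B)) B')"
    using mem mem' by (intro msum_swap[OF C] C.smult_closed mcoeff_closed[OF C M])
      (auto simp: lin_functional_closed[OF mem(2)])
  also have "\<dots> = msum C (map (\<lambda>(e, \<phi>). mcoeff C \<rho> \<phi> e) B')"
    using mcoeff_expand_vector[OF C M mem'(2) B mem'(1)]
    by (intro arg_cong[of _ _ "msum C"] map_cong) (auto simp: case_prod_unfold)
  finally show ?thesis
    using comod_trace_id[OF C M] B B' by simp
qed

text \<open>The choice inside the rank is removed here once and for all, so later each comodule can
  be given an adapted dual basis, transported or glued.\<close>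

lemma comod_rank_eq:
  assumes "module K C" "comodule K C \<Delta> \<epsilon> M \<rho>" "dual_basis K M B"
  shows "comod_rank K C M \<rho> = msum C (map (\<lambda>(e, \<phi>). mcoeff C \<rho> \<phi> e) B)"
proof -
  have "dual_basis K M (SOME B. dual_basis K M B)" using assms(3) by (rule someI)
  then show ?thesis
    unfolding comod_rank_def using comod_trace_basis_indep[OF assms(1,2)] comod_trace_id assms by metis
qed

section \<open>Dual bases over a finite product of fields\<close>

text \<open>A minimal set of generators of the corner \<open>e M\<close> is a basis over the field \<open>e K\<close>, so the
coefficients (cut down by \<open>e\<close>) are unique and therefore depend linearly on the vector.\<close>

lemma corner_dual_basis_exists:
  assumes M: "module K M" and e: "e \<in> carrier K" "e \<otimes>\<^bsub>K\<^esub> e = e"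
    and inverse: "\<And>x. x \<in> carrier K \<Longrightarrow> e \<otimes>\<^bsub>K\<^esub> x \<noteq> \<zero>\<^bsub>K\<^esub> \<Longrightarrow> \<exists>y\<in>carrier K. (e \<otimes>\<^bsub>K\<^esub> x) \<otimes>\<^bsub>K\<^esub> y = e"
    and fg: "fin_gen K M"
  shows "\<exists>B. (\<forall>(b, \<phi>)\<in>set B. b \<in> carrier M \<and> lin_functional K M \<phi>) \<and>
             (\<forall>m\<in>carrier M. msum M (map (\<lambda>(b, \<phi>). \<phi> m \<odot>\<^bsub>M\<^esub> b) B) = e \<odot>\<^bsub>M\<^esub> m)"
proof -
  interpret module K M by fact
  \<comment> \<open>Coefficients range over \<open>K\<close> and are cut down by \<open>e\<close>
    inside the combination, so no change of ring is made. The vectors themselves may lie outside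
    \<open>e M\<close>; the factor \<open>e\<close> projects them.\<close>
  define lc where "lc a T = finsum M (\<lambda>s. (e \<otimes>\<^bsub>K\<^esub> a s) \<odot>\<^bsub>M\<^esub> s) T" for a T
  define spans where "spans T \<longleftrightarrow> finite T \<and> T \<subseteq> carrier M \<and>
    (\<forall>m\<in>carrier M. \<exists>a\<in>T \<rightarrow> carrier K. e \<odot>\<^bsub>M\<^esub> m = lc a T)" for T
  have lc_smult: "lc (\<lambda>s. r \<otimes>\<^bsub>K\<^esub> a s) T = r \<odot>\<^bsub>M\<^esub> lc a T"
    if "finite T" "T \<subseteq> carrier M" "r \<in> carrier K" "a \<in> T \<rightarrow> carrier K" for r a T
  proof -
    have "r \<odot>\<^bsub>M\<^esub> lc a T = finsum M (\<lambda>s. r \<odot>\<^bsub>M\<^esub> ((e \<otimes>\<^bsub>K\<^esub> a s) \<odot>\<^bsub>M\<^esub> s)) T"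
      unfolding lc_def using that e by (intro finsum_smult_ldistr) (auto simp: Pi_def)
    also have "\<dots> = lc (\<lambda>s. r \<otimes>\<^bsub>K\<^esub> a s) T"
      unfolding lc_def
    proof (rule M.finsum_cong', simp)
      show "(\<lambda>s. (e \<otimes>\<^bsub>K\<^esub> (r \<otimes>\<^bsub>K\<^esub> a s)) \<odot>\<^bsub>M\<^esub> s) \<in> T \<rightarrow> carrier M" using that e by (auto simp: Pi_def)
    next
      fix s assume "s \<in> T"
      then have s: "a s \<in> carrier K" "s \<in> carrier M" using that by auto
      then have "e \<otimes>\<^bsub>K\<^esub> (r \<otimes>\<^bsub>K\<^esub> a s) = r \<otimes>\<^bsub>K\<^esub> (e \<otimes>\<^bsub>K\<^esub> a s)"
        using that(3) e by (simp add: R.m_lcomm)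
      then show "r \<odot>\<^bsub>M\<^esub> ((e \<otimes>\<^bsub>K\<^esub> a s) \<odot>\<^bsub>M\<^esub> s) = (e \<otimes>\<^bsub>K\<^esub> (r \<otimes>\<^bsub>K\<^esub> a s)) \<odot>\<^bsub>M\<^esub> s"
        using s that(3) e by (simp add: smult_assoc1)
    qed
    finally show ?thesis ..
  qed
  have lc_add: "lc (\<lambda>s. a s \<oplus>\<^bsub>K\<^esub> b s) T = lc a T \<oplus>\<^bsub>M\<^esub> lc b T"
    if "finite T" "T \<subseteq> carrier M" "a \<in> T \<rightarrow> carrier K" "b \<in> T \<rightarrow> carrier K" for a b T
  proof -
    have "lc a T \<oplus>\<^bsub>M\<^esub> lc b T = finsum M (\<lambda>s. (e \<otimes>\<^bsub>K\<^esub> a s) \<odot>\<^bsub>M\<^esub> s \<oplus>\<^bsub>M\<^esub> (e \<otimes>\<^bsub>K\<^esub> b s) \<odot>\<^bsub>M\<^esub> s) T"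
      unfolding lc_def using that e by (intro M.finsum_addf[symmetric]) (auto simp: Pi_def)
    also have "\<dots> = lc (\<lambda>s. a s \<oplus>\<^bsub>K\<^esub> b s) T"
      unfolding lc_def using that e
      by (intro M.finsum_cong') (auto simp: Pi_def subset_iff R.r_distr smult_l_distr)
    finally show ?thesis ..
  qed
  have lc_closed: "lc a T \<in> carrier M" if "T \<subseteq> carrier M" "a \<in> T \<rightarrow> carrier K" for a T
    unfolding lc_def using that e by (intro M.finsum_closed) (auto simp: Pi_def)
  have lc_insert: "lc a (insert t T) = (e \<otimes>\<^bsub>K\<^esub> a t) \<odot>\<^bsub>M\<^esub> t \<oplus>\<^bsub>M\<^esub> lc a T"
    if "finite T" "T \<subseteq> carrier M" "t \<in> carrier M" "t \<notin> T" "a \<in> insert t T \<rightarrow> carrier K" for a t T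
    unfolding lc_def using that e by (intro M.finsum_insert) (auto simp: Pi_def)
  obtain S where S: "finite S" "S \<subseteq> carrier M"
    "\<And>m. m \<in> carrier M \<Longrightarrow> \<exists>a \<in> S \<rightarrow> carrier K. m = finsum M (\<lambda>s. a s \<odot>\<^bsub>M\<^esub> s) S"
    using fg unfolding fin_gen_def by blast
  have "spans S"
    unfolding spans_def
  proof (intro conjI ballI S(1,2))
    fix m assume m: "m \<in> carrier M"
    then obtain a where a: "a \<in> S \<rightarrow> carrier K" "m = finsum M (\<lambda>s. a s \<odot>\<^bsub>M\<^esub> s) S" using S(3) by blast
    then have "e \<odot>\<^bsub>M\<^esub> m = finsum M (\<lambda>s. e \<odot>\<^bsub>M\<^esub> (a s \<odot>\<^bsub>M\<^esub> s)) S"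
      using S(1,2) e by (simp, intro finsum_smult_ldistr) (auto simp: Pi_def)
    also have "\<dots> = lc a S"
      unfolding lc_def using S(1,2) e a(1)
      by (intro M.finsum_cong') (auto simp: Pi_def subset_iff smult_assoc1)
    finally show "\<exists>a\<in>S \<rightarrow> carrier K. e \<odot>\<^bsub>M\<^esub> m = lc a S" using a(1) by blast
  qed
  then obtain T where T: "spans T" and T_min: "\<And>T'. spans T' \<Longrightarrow> card T \<le> card T'"
    using ex_has_least_nat[of spans S card] by blast
  then have T_fin: "finite T" and T_sub: "T \<subseteq> carrier M"
    and T_span: "\<And>m. m \<in> carrier M \<Longrightarrow> \<exists>a\<in>T \<rightarrow> carrier K. e \<odot>\<^bsub>M\<^esub> m = lc a T"
    unfolding spans_def by auto
  \<comment> \<open>A nonzero \<open>e d(t)\<close> is invertible in the corner, so the relation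
    eliminates \<open>t\<close> from every combination and gives a smaller spanning set, against the
    minimality of \<open>T\<close>.\<close>
  have indep: "e \<otimes>\<^bsub>K\<^esub> d t = \<zero>\<^bsub>K\<^esub>"
    if d: "d \<in> T \<rightarrow> carrier K" "lc d T = \<zero>\<^bsub>M\<^esub>" and t: "t \<in> T" for d t
  proof (rule ccontr)
    assume nz: "e \<otimes>\<^bsub>K\<^esub> d t \<noteq> \<zero>\<^bsub>K\<^esub>"
    have dt: "d t \<in> carrier K" and tM: "t \<in> carrier M" using d t T_sub by auto
    obtain y where y: "y \<in> carrier K" "(e \<otimes>\<^bsub>K\<^esub> d t) \<otimes>\<^bsub>K\<^esub> y = e" using inverse[OF dt nz] by blast
    let ?T = "T - {t}"
    have T': "finite ?T" "?T \<subseteq> carrier M" "t \<notin> ?T" "insert t ?T = T" using T_fin T_sub t by auto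
    have "spans ?T"
      unfolding spans_def
    proof (intro conjI ballI T')
      fix m assume "m \<in> carrier M"
      then obtain a where a: "a \<in> T \<rightarrow> carrier K" "e \<odot>\<^bsub>M\<^esub> m = lc a T" using T_span by blast
      have at: "a t \<in> carrier K" using a t by auto
      \<comment> \<open>Adding \<open>r\<close> times the relation \<open>d\<close> does not change
        the combination. Since \<open>y\<close> inverts \<open>e d(t)\<close>, this \<open>r\<close>
        makes the coefficient at \<open>t\<close> equal to
        \<open>e a(t) - e a(t) = 0\<close>.\<close>
      define r where "r = \<ominus>\<^bsub>K\<^esub> (y \<otimes>\<^bsub>K\<^esub> a t)"
      have r: "r \<in> carrier K" unfolding r_def using y at by simp
      define b where "b s = a s \<oplus>\<^bsub>K\<^esub> r \<otimes>\<^bsub>K\<^esub> d s" for s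
      have b: "b \<in> T \<rightarrow> carrier K" using a(1) d(1) r by (auto simp: b_def Pi_def)
      have rd: "(\<lambda>s. r \<otimes>\<^bsub>K\<^esub> d s) \<in> T \<rightarrow> carrier K" using d(1) r by (auto simp: Pi_def)
      have "lc b T = lc a T \<oplus>\<^bsub>M\<^esub> r \<odot>\<^bsub>M\<^esub> lc d T"
        unfolding b_def using lc_add[OF T_fin T_sub a(1) rd] lc_smult[OF T_fin T_sub r d(1)] by simp
      then have "lc b T = lc a T" using d r lc_closed[OF T_sub a(1)] by simp
      moreover have "e \<otimes>\<^bsub>K\<^esub> b t = \<zero>\<^bsub>K\<^esub>"
      proof -
        have "e \<otimes>\<^bsub>K\<^esub> (r \<otimes>\<^bsub>K\<^esub> d t) = \<ominus>\<^bsub>K\<^esub> (((e \<otimes>\<^bsub>K\<^esub> d t) \<otimes>\<^bsub>K\<^esub> y) \<otimes>\<^bsub>K\<^esub> a t)"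
          unfolding r_def using e y(1) at dt by (simp add: R.l_minus R.r_minus R.m_ac)
        then show ?thesis
          unfolding b_def using e y at dt r by (simp add: R.r_distr R.r_neg)
      qed
      moreover have "lc b T = (e \<otimes>\<^bsub>K\<^esub> b t) \<odot>\<^bsub>M\<^esub> t \<oplus>\<^bsub>M\<^esub> lc b ?T"
        using lc_insert[OF T'(1,2) tM T'(3), of b] b unfolding T'(4) by simp
      moreover have bT': "b \<in> ?T \<rightarrow> carrier K" using b by auto
      ultimately have "e \<odot>\<^bsub>M\<^esub> m = lc b ?T"
        using a(2) tM lc_closed[OF T'(2) bT'] by simp
      with bT' show "\<exists>a\<in>?T \<rightarrow> carrier K. e \<odot>\<^bsub>M\<^esub> m = lc a ?T" by blast
    qed
    from T_min[OF this] show False using T_fin t by (meson card_Diff1_less leD)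
  qed
  have uniq: "e \<otimes>\<^bsub>K\<^esub> a t = e \<otimes>\<^bsub>K\<^esub> b t"
    if "a \<in> T \<rightarrow> carrier K" "b \<in> T \<rightarrow> carrier K" "lc a T = lc b T" "t \<in> T" for a b t
  proof -
    \<comment> \<open>The difference is written with the scalar \<open>-1\<close>, so that
      \<open>lc_add\<close> and \<open>lc_smult\<close> apply.\<close>
    have mb: "(\<lambda>s. \<ominus>\<^bsub>K\<^esub> \<one>\<^bsub>K\<^esub> \<otimes>\<^bsub>K\<^esub> b s) \<in> T \<rightarrow> carrier K" using that(1,2) by (auto simp: Pi_def)
    have ab: "(\<lambda>s. a s \<oplus>\<^bsub>K\<^esub> \<ominus>\<^bsub>K\<^esub> \<one>\<^bsub>K\<^esub> \<otimes>\<^bsub>K\<^esub> b s) \<in> T \<rightarrow> carrier K" using that(1,2) by (auto simp: Pi_def)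
    have at: "a t \<in> carrier K" "b t \<in> carrier K" using that by auto
    have "lc (\<lambda>s. a s \<oplus>\<^bsub>K\<^esub> \<ominus>\<^bsub>K\<^esub> \<one>\<^bsub>K\<^esub> \<otimes>\<^bsub>K\<^esub> b s) T = \<zero>\<^bsub>M\<^esub>"
      using lc_add[OF T_fin T_sub that(1) mb] lc_smult[OF T_fin T_sub _ that(2), of "\<ominus>\<^bsub>K\<^esub> \<one>\<^bsub>K\<^esub>"]
        that(3) lc_closed[OF T_sub that(2)] by (simp add: smult_l_minus M.r_neg)
    from indep[OF ab this that(4)] have "e \<otimes>\<^bsub>K\<^esub> a t \<ominus>\<^bsub>K\<^esub> e \<otimes>\<^bsub>K\<^esub> b t = \<zero>\<^bsub>K\<^esub>"
      using e at by (simp add: R.r_distr R.l_minus R.r_minus R.minus_eq)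
    then show ?thesis using e at by simp
  qed
  \<comment> \<open>An arbitrary choice of coefficients, in general not linear in \<open>m\<close>.
    Only the products with \<open>e\<close> are determined by \<open>uniq\<close>, and these are
    what the functionals use.\<close>
  define coord where "coord m = (SOME a. a \<in> T \<rightarrow> carrier K \<and> e \<odot>\<^bsub>M\<^esub> m = lc a T)" for m
  have coord: "coord m \<in> T \<rightarrow> carrier K" "e \<odot>\<^bsub>M\<^esub> m = lc (coord m) T" if "m \<in> carrier M" for m
  proof -
    have "\<exists>a. a \<in> T \<rightarrow> carrier K \<and> e \<odot>\<^bsub>M\<^esub> m = lc a T" using T_span[OF that] by blast
    then have "coord m \<in> T \<rightarrow> carrier K \<and> e \<odot>\<^bsub>M\<^esub> m = lc (coord m) T"
      unfolding coord_def by (rule someI_ex)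
    then show "coord m \<in> T \<rightarrow> carrier K" "e \<odot>\<^bsub>M\<^esub> m = lc (coord m) T" by auto
  qed
  have functional: "lin_functional K M (\<lambda>m. e \<otimes>\<^bsub>K\<^esub> coord m t)" if t: "t \<in> T" for t
    unfolding lin_functional_def
  proof (intro conjI ballI)
    show "(\<lambda>m. e \<otimes>\<^bsub>K\<^esub> coord m t) \<in> carrier M \<rightarrow> carrier K"
      using coord(1) t e by (auto simp: Pi_def)
  next
    fix x y assume xy: "x \<in> carrier M" "y \<in> carrier M"
    have "lc (coord (x \<oplus>\<^bsub>M\<^esub> y)) T = lc (\<lambda>s. coord x s \<oplus>\<^bsub>K\<^esub> coord y s) T"
      using xy e coord(2) by (simp add: lc_add T_fin T_sub coord(1) smult_r_distr flip: coord(2))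
    then have "e \<otimes>\<^bsub>K\<^esub> coord (x \<oplus>\<^bsub>M\<^esub> y) t = e \<otimes>\<^bsub>K\<^esub> (coord x t \<oplus>\<^bsub>K\<^esub> coord y t)"
      using xy coord(1) by (intro uniq[OF _ _ _ t]) (auto simp: Pi_def)
    then show "e \<otimes>\<^bsub>K\<^esub> coord (x \<oplus>\<^bsub>M\<^esub> y) t = e \<otimes>\<^bsub>K\<^esub> coord x t \<oplus>\<^bsub>K\<^esub> e \<otimes>\<^bsub>K\<^esub> coord y t"
      using coord(1)[OF xy(1)] coord(1)[OF xy(2)] t e by (auto simp: Pi_def R.r_distr)
  next
    fix r x assume rx: "r \<in> carrier K" "x \<in> carrier M"
    have "lc (coord (r \<odot>\<^bsub>M\<^esub> x)) T = lc (\<lambda>s. r \<otimes>\<^bsub>K\<^esub> coord x s) T"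
    proof -
      have "e \<odot>\<^bsub>M\<^esub> (r \<odot>\<^bsub>M\<^esub> x) = r \<odot>\<^bsub>M\<^esub> (e \<odot>\<^bsub>M\<^esub> x)" using rx e by (metis smult_assoc1 R.m_comm)
      then show ?thesis
        using rx e by (simp add: lc_smult T_fin T_sub coord(1) flip: coord(2))
    qed
    then have "e \<otimes>\<^bsub>K\<^esub> coord (r \<odot>\<^bsub>M\<^esub> x) t = e \<otimes>\<^bsub>K\<^esub> (r \<otimes>\<^bsub>K\<^esub> coord x t)"
      using rx coord(1) by (intro uniq[OF _ _ _ t]) (auto simp: Pi_def)
    then show "e \<otimes>\<^bsub>K\<^esub> coord (r \<odot>\<^bsub>M\<^esub> x) t = r \<otimes>\<^bsub>K\<^esub> (e \<otimes>\<^bsub>K\<^esub> coord x t)"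
      using coord(1)[OF rx(2)] t e rx by (auto simp: Pi_def R.m_lcomm)
  qed
  obtain ts where ts: "set ts = T" "distinct ts" using T_fin finite_distinct_list by blast
  let ?B = "map (\<lambda>t. (t, \<lambda>m. e \<otimes>\<^bsub>K\<^esub> coord m t)) ts"
  show ?thesis
  proof (intro exI[of _ ?B] conjI ballI)
    fix p assume "p \<in> set ?B"
    then show "case p of (b, \<phi>) \<Rightarrow> b \<in> carrier M \<and> lin_functional K M \<phi>"
      using functional ts T_sub by auto
  next
    fix m assume m: "m \<in> carrier M"
    have "msum M (map (\<lambda>(b, \<phi>). \<phi> m \<odot>\<^bsub>M\<^esub> b) ?B) = msum M (map (\<lambda>t. (e \<otimes>\<^bsub>K\<^esub> coord m t) \<odot>\<^bsub>M\<^esub> t) ts)"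
      by (simp add: comp_def)
    also have "\<dots> = lc (coord m) T"
      unfolding lc_def ts(1)[symmetric] using coord(1)[OF m] T_sub e ts
      by (intro finsum_eq_msum[OF M, symmetric]) (auto simp: Pi_def)
    finally show "msum M (map (\<lambda>(b, \<phi>). \<phi> m \<odot>\<^bsub>M\<^esub> b) ?B) = e \<odot>\<^bsub>M\<^esub> m"
      using coord(2)[OF m] by simp
  qed
qed

text \<open>Each corner dual basis reproduces \<open>e m\<close>, and the idempotents add up to
  \<open>1\<close>; concatenating over all corners therefore reproduces \<open>m\<close>.\<close>

lemma dual_basis_exists:
  assumes K: "fin_prod_fields K" and M: "module K M" and fg: "fin_gen K M"
  shows "\<exists>B. dual_basis K M B"
proof -
  interpret module K M by fact
  obtain E where E: "finite E" "E \<subseteq> carrier K"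
    "\<And>e. e \<in> E \<Longrightarrow> e \<otimes>\<^bsub>K\<^esub> e = e"
    "\<And>e x. e \<in> E \<Longrightarrow> x \<in> carrier K \<Longrightarrow> e \<otimes>\<^bsub>K\<^esub> x \<noteq> \<zero>\<^bsub>K\<^esub> \<Longrightarrow> \<exists>y\<in>carrier K. (e \<otimes>\<^bsub>K\<^esub> x) \<otimes>\<^bsub>K\<^esub> y = e"
    "finsum K (\<lambda>e. e) E = \<one>\<^bsub>K\<^esub>"
    using K unfolding fin_prod_fields_def id_def by metis
  have "\<forall>e\<in>E. \<exists>B. (\<forall>(b, \<phi>)\<in>set B. b \<in> carrier M \<and> lin_functional K M \<phi>) \<and>
             (\<forall>m\<in>carrier M. msum M (map (\<lambda>(b, \<phi>). \<phi> m \<odot>\<^bsub>M\<^esub> b) B) = e \<odot>\<^bsub>M\<^esub> m)"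
    using E(2-4) by (intro ballI corner_dual_basis_exists[OF M _ _ _ fg]) auto
  then obtain B where B_mem: "\<And>e b \<phi>. e \<in> E \<Longrightarrow> (b, \<phi>) \<in> set (B e) \<Longrightarrow> b \<in> carrier M \<and> lin_functional K M \<phi>"
    and B_sum: "\<And>e m. e \<in> E \<Longrightarrow> m \<in> carrier M \<Longrightarrow> msum M (map (\<lambda>(b, \<phi>). \<phi> m \<odot>\<^bsub>M\<^esub> b) (B e)) = e \<odot>\<^bsub>M\<^esub> m"
    by (simp only: Ball_def bchoice_iff split_paired_All case_prod_conv) metis
  obtain es where es: "set es = E" "distinct es" using E(1) finite_distinct_list by blast
  have "dual_basis K M (concat (map B es))"
    unfolding dual_basis_def
  proof (intro conjI ballI)
    fix p assume "p \<in> set (concat (map B es))"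
    then show "case p of (b, \<phi>) \<Rightarrow> b \<in> carrier M \<and> lin_functional K M \<phi>"
      using B_mem es by (auto split: prod.splits)
  next
    fix m assume m: "m \<in> carrier M"
    have "msum M (map (\<lambda>(b, \<phi>). \<phi> m \<odot>\<^bsub>M\<^esub> b) (concat (map B es)))
        = msum M (map (msum M) (map (\<lambda>e. map (\<lambda>(b, \<phi>). \<phi> m \<odot>\<^bsub>M\<^esub> b) (B e)) es))"
      unfolding map_concat map_map comp_def
    proof (subst msum_concat[OF M])
      fix xs assume "xs \<in> set (map (\<lambda>e. map (\<lambda>(b, \<phi>). \<phi> m \<odot>\<^bsub>M\<^esub> b) (B e)) es)"
      then show "set xs \<subseteq> carrier M"
        using B_mem m es by (fastforce simp: lin_functional_closed)
    qed (simp add: comp_def)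
    also have "map (msum M) (map (\<lambda>e. map (\<lambda>(b, \<phi>). \<phi> m \<odot>\<^bsub>M\<^esub> b) (B e)) es) = map (\<lambda>e. e \<odot>\<^bsub>M\<^esub> m) es"
      using B_sum m es by simp
    also have "msum M \<dots> = finsum M (\<lambda>e. e \<odot>\<^bsub>M\<^esub> m) E"
      unfolding es(1)[symmetric] using es E(2) m by (intro finsum_eq_msum[OF M, symmetric]) auto
    also have "\<dots> = finsum K (\<lambda>e. e) E \<odot>\<^bsub>M\<^esub> m"
      using E(1,2)
    proof (induction E rule: finite_induct)
      case (insert x F)
      then have "finsum M (\<lambda>e. e \<odot>\<^bsub>M\<^esub> m) (insert x F) = x \<odot>\<^bsub>M\<^esub> m \<oplus>\<^bsub>M\<^esub> finsum M (\<lambda>e. e \<odot>\<^bsub>M\<^esub> m) F"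
        using m by (intro M.finsum_insert) (auto simp: Pi_def)
      moreover have "finsum K (\<lambda>e. e) (insert x F) = x \<oplus>\<^bsub>K\<^esub> finsum K (\<lambda>e. e) F"
        using insert by (intro R.finsum_insert) auto
      moreover have "finsum K (\<lambda>e. e) F \<in> carrier K"
        using insert by (intro R.finsum_closed) auto
      ultimately show ?case using insert m by (simp add: smult_l_distr)
    qed (use m in simp)
    finally show "m = msum M (map (\<lambda>(b, \<phi>). \<phi> m \<odot>\<^bsub>M\<^esub> b) (concat (map B es)))"
      using E(5) m by simp
  qed
  then show ?thesis ..
qed

section \<open>The rank is cocommutative\<close>

lemma coalgebra_comult_mem:
  assumes "coalgebra K C \<Delta> \<epsilon>" "c \<in> carrier C" "(u, v) \<in> set (\<Delta> c)"
  shows "u \<in> carrier C" "v \<in> carrier C"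
  using assms unfolding coalgebra_def by blast+

text \<open>Homogeneity at the scalar \<open>0\<close> replaces every left factor of
  \<open>\<Delta> 0\<close> by zero, and such tensors vanish.\<close>

lemma comult_zero:
  assumes C: "coalgebra K C \<Delta> \<epsilon>"
  shows "tens_eq K C C (\<Delta> \<zero>\<^bsub>C\<^esub>) []"
proof -
  interpret module K C using coalgebra_module[OF C] .
  have "\<forall>r\<in>carrier K. \<forall>a\<in>carrier C. tens_eq K C C (\<Delta> (r \<odot>\<^bsub>C\<^esub> a)) (map (\<lambda>(x, y). (r \<odot>\<^bsub>C\<^esub> x, y)) (\<Delta> a))"
    using C by (simp add: coalgebra_def)
  then have "tens_eq K C C (\<Delta> (\<zero>\<^bsub>K\<^esub> \<odot>\<^bsub>C\<^esub> \<zero>\<^bsub>C\<^esub>)) (map (\<lambda>(x, y). (\<zero>\<^bsub>K\<^esub> \<odot>\<^bsub>C\<^esub> x, y)) (\<Delta> \<zero>\<^bsub>C\<^esub>))"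
    by blast
  moreover have "tens_eq K C C (map (\<lambda>(x, y). (\<zero>\<^bsub>K\<^esub> \<odot>\<^bsub>C\<^esub> x, y)) xs) []" if "set xs \<subseteq> carrier C \<times> carrier C" for xs
    using that
  proof (induction xs)
    case (Cons p xs)
    obtain x y where p: "p = (x, y)" by fastforce
    have "tens_eq K C C ([(\<zero>\<^bsub>C\<^esub>, y)] @ map (\<lambda>(x, y). (\<zero>\<^bsub>K\<^esub> \<odot>\<^bsub>C\<^esub> x, y)) xs) ([] @ [])"
      using Cons p by (intro tens_eq_append tens_eq.zero) auto
    then show ?case using Cons p by simp
  qed (simp add: tens_eq.refl)
  moreover have "set (\<Delta> \<zero>\<^bsub>C\<^esub>) \<subseteq> carrier C \<times> carrier C"
    using C by (simp add: coalgebra_def)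
  ultimately show ?thesis
    using tens_eq.trans by fastforce
qed

lemma comult_msum:
  assumes C: "coalgebra K C \<Delta> \<epsilon>" and cs: "set cs \<subseteq> carrier C"
  shows "tens_eq K C C (\<Delta> (msum C cs)) (concat (map \<Delta> cs))"
  using cs
proof (induction cs)
  case Nil
  then show ?case by (simp add: comult_zero[OF C])
next
  case (Cons c cs)
  then have "tens_eq K C C (\<Delta> (c \<oplus>\<^bsub>C\<^esub> msum C cs)) (\<Delta> c @ \<Delta> (msum C cs))"
    using C msum_closed[OF coalgebra_module[OF C]] by (simp add: coalgebra_def)
  moreover have "tens_eq K C C (\<Delta> c @ \<Delta> (msum C cs)) (\<Delta> c @ concat (map \<Delta> cs))"
    using Cons by (intro tens_eq_append tens_eq.refl) auto
  ultimately show ?case by (auto intro: tens_eq.trans)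
qed

text \<open>Coassociativity says that matrix coefficients comultiply like the entries of a matrix.\<close>

lemma comult_mcoeff:
  assumes C: "coalgebra K C \<Delta> \<epsilon>" and M: "comodule K C \<Delta> \<epsilon> M \<rho>"
    and \<phi>: "lin_functional K M \<phi>" and B: "dual_basis K M B" and m: "m \<in> carrier M"
  shows "tens_eq K C C (\<Delta> (mcoeff C \<rho> \<phi> m)) (map (\<lambda>(e, \<psi>). (mcoeff C \<rho> \<phi> e, mcoeff C \<rho> \<psi> m)) B)"
proof -
  note C_mod = coalgebra_module[OF C] and M_mod = comodule_module[OF M]
  interpret C: module K C by (rule C_mod)
  interpret M: module K M by (rule M_mod)
  note \<phi>_cl = lin_functional_closed[OF \<phi>]
  note \<rho>_cl = comodule_mem[OF M m]
  note B_mem = dual_basis_mem[OF B]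
  \<comment> \<open>\<open>?F\<close> is \<open>\<phi> \<otimes> id \<otimes> id\<close>. Applied to
    \<open>(id \<otimes> \<Delta>) \<rho>(m)\<close> it gives \<open>\<Delta>\<close> of the
    coefficient; applied to \<open>(\<rho> \<otimes> id) \<rho>(m)\<close> it gives the sum of
    \<open>mcoeff C \<rho> \<phi> x \<otimes> y\<close> over the terms \<open>(x, y)\<close> of
    \<open>\<rho> m\<close>. Coassociativity identifies the two.\<close>
  let ?F = "\<lambda>(x, b, c). (\<phi> x \<odot>\<^bsub>C\<^esub> b, c)"
  have "tens_eq K C C (\<Delta> (mcoeff C \<rho> \<phi> m)) (concat (map \<Delta> (map (\<lambda>(x, c). \<phi> x \<odot>\<^bsub>C\<^esub> c) (\<rho> m))))"
    unfolding mcoeff_def by (rule comult_msum[OF C mcoeff_terms_closed[OF C_mod M \<phi> m]])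
  also have "concat (map \<Delta> (map (\<lambda>(x, c). \<phi> x \<odot>\<^bsub>C\<^esub> c) (\<rho> m))) = concat (map (\<lambda>(x, c). \<Delta> (\<phi> x \<odot>\<^bsub>C\<^esub> c)) (\<rho> m))"
    by (simp add: comp_def case_prod_unfold)
  finally have 1: "tens_eq K C C (\<Delta> (mcoeff C \<rho> \<phi> m)) (concat (map (\<lambda>(x, c). \<Delta> (\<phi> x \<odot>\<^bsub>C\<^esub> c)) (\<rho> m)))" .
  have "tens_eq K C C (concat (map (\<lambda>(x, c). \<Delta> (\<phi> x \<odot>\<^bsub>C\<^esub> c)) (\<rho> m)))
      (concat (map (\<lambda>(x, c). map (\<lambda>(u, v). (\<phi> x \<odot>\<^bsub>C\<^esub> u, v)) (\<Delta> c)) (\<rho> m)))"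
    using C \<rho>_cl \<phi>_cl by (intro tens_eq_concat_map) (auto simp: coalgebra_def)
  also have "concat (map (\<lambda>(x, c). map (\<lambda>(u, v). (\<phi> x \<odot>\<^bsub>C\<^esub> u, v)) (\<Delta> c)) (\<rho> m))
      = map ?F (concat (map (\<lambda>(x, y). map (\<lambda>(u, v). (x, u, v)) (\<Delta> y)) (\<rho> m)))"
    by (simp add: map_concat comp_def case_prod_unfold)
  finally have 2: "tens_eq K C C (concat (map (\<lambda>(x, c). \<Delta> (\<phi> x \<odot>\<^bsub>C\<^esub> c)) (\<rho> m)))
      (map ?F (concat (map (\<lambda>(x, y). map (\<lambda>(u, v). (x, u, v)) (\<Delta> y)) (\<rho> m))))" .
  have "tens3_eq K M C C (concat (map (\<lambda>(x, y). map (\<lambda>(u, v). (u, v, y)) (\<rho> x)) (\<rho> m)))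
        (concat (map (\<lambda>(x, y). map (\<lambda>(u, v). (x, u, v)) (\<Delta> y)) (\<rho> m)))"
    using M m by (simp add: comodule_def)
  then have "tens_eq K C C (map ?F (concat (map (\<lambda>(x, y). map (\<lambda>(u, v). (x, u, v)) (\<Delta> y)) (\<rho> m))))
      (map ?F (concat (map (\<lambda>(x, y). map (\<lambda>(u, v). (u, v, y)) (\<rho> x)) (\<rho> m))))"
    by (intro tens_eq.sym[OF tens3_eq_contract[OF M_mod C_mod C_mod \<phi>]])
  also have "map ?F (concat (map (\<lambda>(x, y). map (\<lambda>(u, v). (u, v, y)) (\<rho> x)) (\<rho> m)))
      = concat (map (\<lambda>(x, y). map (\<lambda>c. (c, y)) (map (\<lambda>(u, v). \<phi> u \<odot>\<^bsub>C\<^esub> v) (\<rho> x))) (\<rho> m))"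
    by (simp add: map_concat comp_def case_prod_unfold)
  finally have 3: "tens_eq K C C (map ?F (concat (map (\<lambda>(x, y). map (\<lambda>(u, v). (x, u, v)) (\<Delta> y)) (\<rho> m))))
      (concat (map (\<lambda>(x, y). map (\<lambda>c. (c, y)) (map (\<lambda>(u, v). \<phi> u \<odot>\<^bsub>C\<^esub> v) (\<rho> x))) (\<rho> m)))" .
  \<comment> \<open>The coefficient at \<open>x\<close> is expanded along \<open>B\<close>, and the
    scalars \<open>\<psi> x\<close> are moved to the right factor, where they can meet the second
    leg \<open>y\<close>.\<close>
  have 4: "tens_eq K C C (concat (map (\<lambda>(x, y). map (\<lambda>c. (c, y)) (map (\<lambda>(u, v). \<phi> u \<odot>\<^bsub>C\<^esub> v) (\<rho> x))) (\<rho> m)))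
      (concat (map (\<lambda>(x, y). map (\<lambda>(e, \<psi>). (mcoeff C \<rho> \<phi> e, \<psi> x \<odot>\<^bsub>C\<^esub> y)) B) (\<rho> m)))"
  proof (rule tens_eq_concat_map, clarify)
    fix x y assume "(x, y) \<in> set (\<rho> m)"
    note xy = \<rho>_cl[OF this]
    have "tens_eq K C C (map (\<lambda>c. (c, y)) (map (\<lambda>(u, v). \<phi> u \<odot>\<^bsub>C\<^esub> v) (\<rho> x))) [(mcoeff C \<rho> \<phi> x, y)]"
      unfolding mcoeff_def
      by (rule tens_eq.sym[OF tens_eq_msumL[OF C_mod C_mod mcoeff_terms_closed[OF C_mod M \<phi> xy(1)] xy(2)]])
    moreover have "tens_eq K C C [(mcoeff C \<rho> \<phi> x, y)]
        (map (\<lambda>c. (c, y)) (map (\<lambda>(e, \<psi>). \<psi> x \<odot>\<^bsub>C\<^esub> mcoeff C \<rho> \<phi> e) B))"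
      unfolding mcoeff_expand_vector[OF C_mod M \<phi> B xy(1)]
    proof (rule tens_eq_msumL[OF C_mod C_mod _ xy(2)], clarsimp)
      fix e \<psi> assume "(e, \<psi>) \<in> set B"
      with B_mem xy show "\<psi> x \<odot>\<^bsub>C\<^esub> mcoeff C \<rho> \<phi> e \<in> carrier C"
        by (intro C.smult_closed mcoeff_closed[OF C_mod M \<phi>] lin_functional_closed[of K M \<psi>]) auto
    qed
    moreover have "tens_eq K C C (map (\<lambda>(e, \<psi>). (\<psi> x \<odot>\<^bsub>C\<^esub> mcoeff C \<rho> \<phi> e, y)) B)
        (map (\<lambda>(e, \<psi>). (mcoeff C \<rho> \<phi> e, \<psi> x \<odot>\<^bsub>C\<^esub> y)) B)"
    proof (rule tens_eq_map, clarsimp)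
      fix e \<psi> assume "(e, \<psi>) \<in> set B"
      with B_mem xy show "tens_eq K C C [(\<psi> x \<odot>\<^bsub>C\<^esub> mcoeff C \<rho> \<phi> e, y)] [(mcoeff C \<rho> \<phi> e, \<psi> x \<odot>\<^bsub>C\<^esub> y)]"
        by (intro tens_eq.smul mcoeff_closed[OF C_mod M \<phi>] lin_functional_closed[of K M \<psi>]) auto
    qed
    ultimately show "tens_eq K C C (map (\<lambda>c. (c, y)) (map (\<lambda>(u, v). \<phi> u \<odot>\<^bsub>C\<^esub> v) (\<rho> x)))
       (map (\<lambda>(e, \<psi>). (mcoeff C \<rho> \<phi> e, \<psi> x \<odot>\<^bsub>C\<^esub> y)) B)"
      unfolding map_map comp_def case_prod_unfold by (blast intro: tens_eq.trans)
  qed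
  \<comment> \<open>With the basis index outermost, the right factors belonging to a fixed
    \<open>\<psi>\<close> add up over \<open>\<rho> m\<close> to the coefficient of
    \<open>\<psi>\<close> at \<open>m\<close>.\<close>
  have 5: "tens_eq K C C (concat (map (\<lambda>(x, y). map (\<lambda>(e, \<psi>). (mcoeff C \<rho> \<phi> e, \<psi> x \<odot>\<^bsub>C\<^esub> y)) B) (\<rho> m)))
      (concat (map (\<lambda>(e, \<psi>). map (\<lambda>c. (mcoeff C \<rho> \<phi> e, c)) (map (\<lambda>(x, y). \<psi> x \<odot>\<^bsub>C\<^esub> y) (\<rho> m))) B))"
    using mset_concat_map_swap[of "\<lambda>p q. (mcoeff C \<rho> \<phi> (fst q), snd q (fst p) \<odot>\<^bsub>C\<^esub> snd p)" B "\<rho> m"]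
    by (intro tens_eq_mset) (simp add: comp_def case_prod_unfold)
  have "tens_eq K C C (concat (map (\<lambda>(e, \<psi>). map (\<lambda>c. (mcoeff C \<rho> \<phi> e, c)) (map (\<lambda>(x, y). \<psi> x \<odot>\<^bsub>C\<^esub> y) (\<rho> m))) B))
      (concat (map (\<lambda>(e, \<psi>). [(mcoeff C \<rho> \<phi> e, mcoeff C \<rho> \<psi> m)]) B))"
  proof (rule tens_eq_concat_map, clarify)
    fix e \<psi> assume "(e, \<psi>) \<in> set B"
    note e = B_mem[OF this]
    show "tens_eq K C C (map (\<lambda>c. (mcoeff C \<rho> \<phi> e, c)) (map (\<lambda>(x, y). \<psi> x \<odot>\<^bsub>C\<^esub> y) (\<rho> m)))
        [(mcoeff C \<rho> \<phi> e, mcoeff C \<rho> \<psi> m)]"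
      unfolding mcoeff_def[of C \<rho> \<psi> m]
      by (rule tens_eq.sym[OF tens_eq_msumR[OF C_mod C_mod mcoeff_terms_closed[OF C_mod M e(2) m]
            mcoeff_closed[OF C_mod M \<phi> e(1)]]])
  qed
  also have "concat (map (\<lambda>(e, \<psi>). [(mcoeff C \<rho> \<phi> e, mcoeff C \<rho> \<psi> m)]) B)
      = map (\<lambda>(e, \<psi>). (mcoeff C \<rho> \<phi> e, mcoeff C \<rho> \<psi> m)) B"
    by (simp add: case_prod_unfold)
  finally show ?thesis
    using 1 2 3 4 5 tens_eq.trans by blast
qed

lemma comod_rank_in_coHH0:
  assumes C: "coalgebra K C \<Delta> \<epsilon>" and M: "comodule K C \<Delta> \<epsilon> M \<rho>" and B: "dual_basis K M B"
  shows "comod_rank K C M \<rho> \<in> coHH0 K C \<Delta>"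
proof -
  note C_mod = coalgebra_module[OF C]
  note B_mem = dual_basis_mem[OF B]
  let ?t = "msum C (map (\<lambda>(e, \<phi>). mcoeff C \<rho> \<phi> e) B)"
  let ?X = "concat (map (\<lambda>p. map (\<lambda>q. (mcoeff C \<rho> (snd p) (fst q), mcoeff C \<rho> (snd q) (fst p))) B) B)"
  let ?swap = "map (\<lambda>(x, y). (y, x))"
  have cl: "set (map (\<lambda>(e, \<phi>). mcoeff C \<rho> \<phi> e) B) \<subseteq> carrier C"
    using mcoeff_closed[OF C_mod M] B_mem by auto
  have "tens_eq K C C (\<Delta> ?t) (concat (map \<Delta> (map (\<lambda>(e, \<phi>). mcoeff C \<rho> \<phi> e) B)))"
    by (rule comult_msum[OF C cl])
  also have "concat (map \<Delta> (map (\<lambda>(e, \<phi>). mcoeff C \<rho> \<phi> e) B)) = concat (map (\<lambda>p. \<Delta> (mcoeff C \<rho> (snd p) (fst p))) B)"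
    by (simp add: comp_def case_prod_unfold)
  finally have "tens_eq K C C (\<Delta> ?t) (concat (map (\<lambda>p. \<Delta> (mcoeff C \<rho> (snd p) (fst p))) B))" .
  moreover have "tens_eq K C C (concat (map (\<lambda>p. \<Delta> (mcoeff C \<rho> (snd p) (fst p))) B)) ?X"
    using comult_mcoeff[OF C M _ B] B_mem by (intro tens_eq_concat_map) (auto simp: case_prod_unfold)
  ultimately have X: "tens_eq K C C (\<Delta> ?t) ?X" by (rule tens_eq.trans)
  \<comment> \<open>The entry at \<open>(p, q)\<close> is \<open>c_pq \<otimes> c_qp\<close>, so
    exchanging tensor factors transposes the square array and leaves its multiset unchanged.\<close>
  have "mset (?swap ?X) = mset ?X"
    using mset_concat_map_swap[of "\<lambda>p q. (mcoeff C \<rho> (snd q) (fst p), mcoeff C \<rho> (snd p) (fst q))" B B]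
    by (simp add: map_concat comp_def)
  then have "tens_eq K C C ?X (?swap ?X)" by (intro tens_eq_mset) simp
  moreover have "tens_eq K C C (?swap ?X) (?swap (\<Delta> ?t))"
    by (rule tens_eq_swap[OF C_mod C_mod tens_eq.sym[OF X]])
  ultimately have "tens_eq K C C (\<Delta> ?t) (?swap (\<Delta> ?t))"
    using X tens_eq.trans by blast
  then show ?thesis
    unfolding comod_rank_eq[OF C_mod M B] coHH0_def using msum_closed[OF C_mod cl] by simp
qed

text \<open>This makes \<open>coHH0\<close> a group that can serve as the target of the universal
  properties, so the final map takes values in it by construction.\<close>

lemma subgroup_coHH0:
  assumes C: "coalgebra K C \<Delta> \<epsilon>"
  shows "subgroup (coHH0 K C \<Delta>) (add_monoid C)"
proof -
  note C_mod = coalgebra_module[OF C]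
  interpret C: module K C by (rule C_mod)
  let ?swap = "map (\<lambda>(x, y). (y, x))"
  note swap = tens_eq_swap[OF C_mod C_mod]
  have zero: "\<zero>\<^bsub>C\<^esub> \<in> coHH0 K C \<Delta>"
    using comult_zero[OF C] swap[OF comult_zero[OF C]]
    by (auto simp: coHH0_def intro: tens_eq.sym tens_eq.trans)
  have add: "a \<oplus>\<^bsub>C\<^esub> b \<in> coHH0 K C \<Delta>" if "a \<in> coHH0 K C \<Delta>" "b \<in> coHH0 K C \<Delta>" for a b
  proof -
    have ab: "a \<in> carrier C" "b \<in> carrier C" "tens_eq K C C (\<Delta> a) (?swap (\<Delta> a))" "tens_eq K C C (\<Delta> b) (?swap (\<Delta> b))"
      using that by (auto simp: coHH0_def)
    then have 1: "tens_eq K C C (\<Delta> (a \<oplus>\<^bsub>C\<^esub> b)) (\<Delta> a @ \<Delta> b)" using C by (simp add: coalgebra_def)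
    have 2: "tens_eq K C C (\<Delta> a @ \<Delta> b) (?swap (\<Delta> a @ \<Delta> b))"
      using tens_eq_append[OF ab(3,4)] by simp
    from 1 2 swap[OF tens_eq.sym[OF 1]]
    have "tens_eq K C C (\<Delta> (a \<oplus>\<^bsub>C\<^esub> b)) (?swap (\<Delta> (a \<oplus>\<^bsub>C\<^esub> b)))"
      by (blast intro: tens_eq.trans)
    with ab show ?thesis by (simp add: coHH0_def)
  qed
  \<comment> \<open>Closure under scalars serves negation: the axioms of a coalgebra say nothing on
    \<open>\<Delta>\<close> of a negative directly, but they do on \<open>(-1) a\<close>.\<close>
  have smult: "r \<odot>\<^bsub>C\<^esub> a \<in> coHH0 K C \<Delta>" if "a \<in> coHH0 K C \<Delta>" "r \<in> carrier K" for a r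
  proof -
    have a: "a \<in> carrier C" "tens_eq K C C (\<Delta> a) (?swap (\<Delta> a))" 
      using that by (auto simp: coHH0_def)
    note mem = coalgebra_comult_mem[OF C a(1)]
    let ?r = "map (\<lambda>(x, y). (r \<odot>\<^bsub>C\<^esub> x, y))"
    have 1: "tens_eq K C C (\<Delta> (r \<odot>\<^bsub>C\<^esub> a)) (?r (\<Delta> a))"
      using C a that(2) by (simp add: coalgebra_def)
    have 2: "tens_eq K C C (?r xs) (?r ys)" if "tens_eq K C C xs ys" for xs ys
      using that
    proof induction
      case (trans xs ys zs)
      then show ?case by (blast intro: tens_eq.trans)
    next
      case (smul s a b)
      then have "r \<odot>\<^bsub>C\<^esub> (s \<odot>\<^bsub>C\<^esub> a) = s \<odot>\<^bsub>C\<^esub> (r \<odot>\<^bsub>C\<^esub> a)"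
        using \<open>r \<in> carrier K\<close> by (metis C.smult_assoc1 C.R.m_comm)
      with smul \<open>r \<in> carrier K\<close> show ?case by (simp add: tens_eq.smul)
    qed (use \<open>r \<in> carrier K\<close> in \<open>auto intro: tens_eq.intros simp: C.smult_r_distr\<close>)
    \<comment> \<open>Scaling before and after the twist puts \<open>r\<close> on different tensor
      factors; balancing over \<open>K\<close> reconciles them.\<close>
    have 3: "tens_eq K C C (?r (?swap (\<Delta> a))) (?swap (?r (\<Delta> a)))"
      using mem that(2) by (auto simp: comp_def case_prod_unfold intro!: tens_eq_map tens_eq.smul)
    from 1 2[OF a(2)] 3 swap[OF tens_eq.sym[OF 1]]
    have "tens_eq K C C (\<Delta> (r \<odot>\<^bsub>C\<^esub> a)) (?swap (\<Delta> (r \<odot>\<^bsub>C\<^esub> a)))"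
      by (blast intro: tens_eq.trans)
    with a that show ?thesis by (simp add: coHH0_def)
  qed
  have neg: "\<ominus>\<^bsub>C\<^esub> a \<in> coHH0 K C \<Delta>" if "a \<in> coHH0 K C \<Delta>" for a
  proof -
    have "\<ominus>\<^bsub>C\<^esub> a = (\<ominus>\<^bsub>K\<^esub> \<one>\<^bsub>K\<^esub>) \<odot>\<^bsub>C\<^esub> a" using that by (simp add: coHH0_def C.smult_l_minus)
    then show ?thesis using smult[OF that] by simp
  qed
  show ?thesis
  proof (rule subgroup.intro)
    show "coHH0 K C \<Delta> \<subseteq> carrier (add_monoid C)" by (auto simp: coHH0_def)
  qed (use zero add neg in \<open>simp_all add: a_inv_def\<close>)
qed

section \<open>Isomorphism invariance and additivity\<close>

text \<open>The assignment \<open>g\<close> is arbitrary, and linearity comes from the functionals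
  only. As the dual basis may be redundant, the resulting map need not send \<open>e\<close> to
  \<open>g e\<close>; if \<open>g\<close> picks preimages under a linear surjection, it is still a
  section.\<close>

lemma lin_map_section:
  assumes M: "module K M" and N: "module K N" and B: "dual_basis K N B"
    and g: "\<And>e \<phi>. (e, \<phi>) \<in> set B \<Longrightarrow> g e \<in> carrier M"
  shows "lin_map K N M (\<lambda>n. msum M (map (\<lambda>(e, \<phi>). \<phi> n \<odot>\<^bsub>M\<^esub> g e) B))"
proof -
  interpret M: module K M by (rule M)
  have lin: "lin_map K N M (\<lambda>x. \<phi> x \<odot>\<^bsub>M\<^esub> g e)" if "(e, \<phi>) \<in> set B" for e \<phi>
    by (rule lin_map_functional_smult[OF M dual_basis_mem(2)[OF B that] g[OF that]])
  have cl: "(case p of (e, \<phi>) \<Rightarrow> \<phi> n \<odot>\<^bsub>M\<^esub> g e) \<in> carrier M" if "p \<in> set B" "n \<in> carrier N" for p n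
    using lin_map_closed[OF lin] that by (auto split: prod.split)
  have add: "(case p of (e, \<phi>) \<Rightarrow> \<phi> (x \<oplus>\<^bsub>N\<^esub> y) \<odot>\<^bsub>M\<^esub> g e)
      = (case p of (e, \<phi>) \<Rightarrow> \<phi> x \<odot>\<^bsub>M\<^esub> g e) \<oplus>\<^bsub>M\<^esub> (case p of (e, \<phi>) \<Rightarrow> \<phi> y \<odot>\<^bsub>M\<^esub> g e)"
    if "p \<in> set B" "x \<in> carrier N" "y \<in> carrier N" for p x y
    using lin[of "fst p" "snd p"] that by (simp add: lin_map_def case_prod_unfold)
  have smult: "(case p of (e, \<phi>) \<Rightarrow> \<phi> (r \<odot>\<^bsub>N\<^esub> x) \<odot>\<^bsub>M\<^esub> g e) = r \<odot>\<^bsub>M\<^esub> (case p of (e, \<phi>) \<Rightarrow> \<phi> x \<odot>\<^bsub>M\<^esub> g e)"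
    if "p \<in> set B" "x \<in> carrier N" "r \<in> carrier K" for p x r
    using lin[of "fst p" "snd p"] that by (simp add: lin_map_def case_prod_unfold)
  show ?thesis
    unfolding lin_map_def
  proof (intro conjI ballI)
    show "(\<lambda>n. msum M (map (\<lambda>(e, \<phi>). \<phi> n \<odot>\<^bsub>M\<^esub> g e) B)) \<in> carrier N \<rightarrow> carrier M"
      using cl by (auto intro!: msum_closed[OF M])
  next
    fix x y assume xy: "x \<in> carrier N" "y \<in> carrier N"
    have "map (\<lambda>(e, \<phi>). \<phi> (x \<oplus>\<^bsub>N\<^esub> y) \<odot>\<^bsub>M\<^esub> g e) B
        = map (\<lambda>p. (case p of (e, \<phi>) \<Rightarrow> \<phi> x \<odot>\<^bsub>M\<^esub> g e) \<oplus>\<^bsub>M\<^esub> (case p of (e, \<phi>) \<Rightarrow> \<phi> y \<odot>\<^bsub>M\<^esub> g e)) B"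
      using add xy by (intro map_cong) auto
    then show "msum M (map (\<lambda>(e, \<phi>). \<phi> (x \<oplus>\<^bsub>N\<^esub> y) \<odot>\<^bsub>M\<^esub> g e) B)
        = msum M (map (\<lambda>(e, \<phi>). \<phi> x \<odot>\<^bsub>M\<^esub> g e) B) \<oplus>\<^bsub>M\<^esub> msum M (map (\<lambda>(e, \<phi>). \<phi> y \<odot>\<^bsub>M\<^esub> g e) B)"
      using cl xy by (simp only: msum_map_add[OF M])
  next
    fix r x assume rx: "r \<in> carrier K" "x \<in> carrier N"
    have "map (\<lambda>(e, \<phi>). \<phi> (r \<odot>\<^bsub>N\<^esub> x) \<odot>\<^bsub>M\<^esub> g e) B = map (\<lambda>y. r \<odot>\<^bsub>M\<^esub> y) (map (\<lambda>(e, \<phi>). \<phi> x \<odot>\<^bsub>M\<^esub> g e) B)"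
      unfolding map_map comp_def using smult rx by (intro map_cong) auto
    then show "msum M (map (\<lambda>(e, \<phi>). \<phi> (r \<odot>\<^bsub>N\<^esub> x) \<odot>\<^bsub>M\<^esub> g e) B)
        = r \<odot>\<^bsub>M\<^esub> msum M (map (\<lambda>(e, \<phi>). \<phi> x \<odot>\<^bsub>M\<^esub> g e) B)"
      using lin_map_msum[OF M M lin_map_smult[OF M rx(1)], of "map (\<lambda>(e, \<phi>). \<phi> x \<odot>\<^bsub>M\<^esub> g e) B"]
        cl[OF _ rx(2)] by (simp only: set_map image_subset_iff) (metis (mono_tags, lifting))
  qed
qed

text \<open>Since \<open>i\<close> is injective, linearity can be checked after applying
  \<open>i\<close>, where the map becomes \<open>q\<close>. Used with the identity as
  \<open>q\<close> to invert an isomorphism, and with a projection onto a kernel to build a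
  retraction.\<close>

lemma lin_map_left_inverse:
  assumes M: "module K M" and N: "module K N" and P: "module K P"
    and i: "lin_map K M N i" "inj_on i (carrier M)"
    and q: "lin_map K P N q" "q ` carrier P \<subseteq> i ` carrier M"
  shows "lin_map K P M (\<lambda>x. inv_into (carrier M) i (q x))"
proof -
  interpret M: module K M by (rule M)
  interpret P: module K P by (rule P)
  let ?h = "\<lambda>x. inv_into (carrier M) i (q x)"
  have h: "?h x \<in> carrier M" "i (?h x) = q x" if "x \<in> carrier P" for x
    using inv_into_into[of "q x" i "carrier M"] f_inv_into_f[of "q x" i "carrier M"] q(2) that by auto
  show ?thesis
    unfolding lin_map_def
  proof (intro conjI ballI)
    show "?h \<in> carrier P \<rightarrow> carrier M" using h by auto
  next
    fix x y assume xy: "x \<in> carrier P" "y \<in> carrier P"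
    then have "i (?h (x \<oplus>\<^bsub>P\<^esub> y)) = i (?h x \<oplus>\<^bsub>M\<^esub> ?h y)"
      using h(2)[of "x \<oplus>\<^bsub>P\<^esub> y"] h(1,2)[of x] h(1,2)[of y] i(1) q(1) by (simp add: lin_map_def)
    then show "?h (x \<oplus>\<^bsub>P\<^esub> y) = ?h x \<oplus>\<^bsub>M\<^esub> ?h y"
      using i(2) h xy by (auto dest: inj_onD)
  next
    fix r x assume rx: "r \<in> carrier K" "x \<in> carrier P"
    then have "i (?h (r \<odot>\<^bsub>P\<^esub> x)) = i (r \<odot>\<^bsub>M\<^esub> ?h x)"
      using h(2)[of "r \<odot>\<^bsub>P\<^esub> x"] h(1,2)[of x] i(1) q(1) by (simp add: lin_map_def)
    then show "?h (r \<odot>\<^bsub>P\<^esub> x) = r \<odot>\<^bsub>M\<^esub> ?h x"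
      using i(2) h rx by (auto dest: inj_onD)
  qed
qed

lemma dual_basis_pushforward:
  assumes M: "module K M" and N: "module K N" and B: "dual_basis K M B"
    and f: "lin_map K M N f" and x: "x \<in> carrier M"
  shows "msum N (map (\<lambda>(e, \<phi>). \<phi> x \<odot>\<^bsub>N\<^esub> f e) B) = f x"
proof -
  interpret M: module K M by (rule M)
  note mem = dual_basis_mem[OF B]
  have "f x = f (msum M (map (\<lambda>(e, \<phi>). \<phi> x \<odot>\<^bsub>M\<^esub> e) B))"
    by (simp add: dual_basis_expand[OF B x])
  also have "\<dots> = msum N (map f (map (\<lambda>(e, \<phi>). \<phi> x \<odot>\<^bsub>M\<^esub> e) B))"
    using mem x by (intro lin_map_msum[OF M N f]) (auto simp: lin_functional_closed[OF mem(2)])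
  also have "map f (map (\<lambda>(e, \<phi>). \<phi> x \<odot>\<^bsub>M\<^esub> e) B) = map (\<lambda>(e, \<phi>). \<phi> x \<odot>\<^bsub>N\<^esub> f e) B"
    using mem x f lin_functional_closed[OF mem(2)] by (auto simp: lin_map_def)
  finally show ?thesis ..
qed

text \<open>The dual basis is transported to \<open>(f e, \<phi> \<circ> g)\<close> with
  \<open>g\<close> the inverse of \<open>f\<close>; by colinearity of \<open>f\<close> the diagonal
  coefficients then agree term by term.\<close>

lemma comod_rank_iso:
  assumes C: "module K C" and M: "comodule K C \<Delta> \<epsilon> M \<rho>" and N: "comodule K C \<Delta> \<epsilon> N \<sigma>"
    and B: "dual_basis K M B" and iso: "comod_iso K C M \<rho> N \<sigma>"
  shows "comod_rank K C N \<sigma> = comod_rank K C M \<rho>"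
proof -
  note M_mod = comodule_module[OF M] and N_mod = comodule_module[OF N]
  note mem = dual_basis_mem[OF B]
  obtain f where f: "comod_hom K C M \<rho> N \<sigma> f" "bij_betw f (carrier M) (carrier N)"
    using iso by (auto simp: comod_iso_def)
  then have f_lin: "lin_map K M N f" by (simp add: comod_hom_def)
  define g where "g = inv_into (carrier M) f"
  have g: "lin_map K N M g"
    unfolding g_def using f(2) by (intro lin_map_left_inverse[OF M_mod N_mod N_mod f_lin])
      (auto simp: lin_map_def bij_betw_def)
  have gf: "g (f x) = x" if "x \<in> carrier M" for x
    unfolding g_def using f(2) that by (simp add: bij_betw_def)
  have fg: "f (g y) = y" "g y \<in> carrier M" if "y \<in> carrier N" for y
    unfolding g_def using f(2) that by (auto simp: bij_betw_def f_inv_into_f inv_into_into)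
  let ?B = "map (\<lambda>(e, \<phi>). (f e, \<phi> \<circ> g)) B"
  have B': "dual_basis K N ?B"
    unfolding dual_basis_def
  proof (intro conjI ballI)
    fix p assume "p \<in> set ?B"
    then show "case p of (e, \<phi>) \<Rightarrow> e \<in> carrier N \<and> lin_functional K N \<phi>"
      using lin_map_closed[OF f_lin] lin_functional_comp[OF g] mem by auto
  next
    fix y assume "y \<in> carrier N"
    then show "y = msum N (map (\<lambda>(e, \<phi>). \<phi> y \<odot>\<^bsub>N\<^esub> e) ?B)"
      using dual_basis_pushforward[OF M_mod N_mod B f_lin, of "g y"] fg
      by (simp add: comp_def case_prod_unfold)
  qed
  have "mcoeff C \<sigma> (\<phi> \<circ> g) (f e) = mcoeff C \<rho> \<phi> e" if "(e, \<phi>) \<in> set B" for e \<phi>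
  proof -
    note e = mem[OF that]
    have "mcoeff C \<sigma> (\<phi> \<circ> g) (f e) = mcoeff C \<rho> (\<phi> \<circ> g \<circ> f) e"
      by (rule comod_hom_mcoeff[OF C N f(1) lin_functional_comp[OF g e(2)] e(1)])
    also have "\<dots> = mcoeff C \<rho> \<phi> e"
      unfolding mcoeff_def using comodule_mem[OF M e(1)] gf
      by (intro arg_cong[of _ _ "msum C"] map_cong) auto
    finally show ?thesis .
  qed
  then have "map (\<lambda>(e, \<phi>). mcoeff C \<sigma> \<phi> e) ?B = map (\<lambda>(e, \<phi>). mcoeff C \<rho> \<phi> e) B"
    by auto
  then show ?thesis
    unfolding comod_rank_eq[OF C M B] comod_rank_eq[OF C N B'] by (rule arg_cong)
qed

text \<open>A dual basis of the quotient yields a linear section, hence a linear retraction onto the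
subcomodule, and the two dual bases glue to one of the middle term.\<close>

lemma comod_rank_ses:
  assumes C: "module K C" and M: "comodule K C \<Delta> \<epsilon> M \<rho>"
    and M1: "comodule K C \<Delta> \<epsilon> M1 \<rho>1" and M2: "comodule K C \<Delta> \<epsilon> M2 \<rho>2"
    and B1: "dual_basis K M1 B1" and B2: "dual_basis K M2 B2"
    and ses: "comod_ses K C M1 \<rho>1 M \<rho> M2 \<rho>2"
  shows "comod_rank K C M \<rho> = comod_rank K C M1 \<rho>1 \<oplus>\<^bsub>C\<^esub> comod_rank K C M2 \<rho>2"
proof -
  note M_mod = comodule_module[OF M] and M1_mod = comodule_module[OF M1] and M2_mod = comodule_module[OF M2]
  interpret M: module K M by (rule M_mod)
  interpret M1: module K M1 by (rule M1_mod)
  interpret M2: module K M2 by (rule M2_mod)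
  note mem1 = dual_basis_mem[OF B1] and mem2 = dual_basis_mem[OF B2]
  obtain i p where i: "comod_hom K C M1 \<rho>1 M \<rho> i" and p: "comod_hom K C M \<rho> M2 \<rho>2 p"
    and i_inj: "inj_on i (carrier M1)" and p_surj: "p ` carrier M = carrier M2"
    and exact: "i ` carrier M1 = {m \<in> carrier M. p m = \<zero>\<^bsub>M2\<^esub>}"
    using ses by (auto simp: comod_ses_def)
  have i_lin: "lin_map K M1 M i" and p_lin: "lin_map K M M2 p" using i p by (auto simp: comod_hom_def)
  note i_cl = lin_map_closed[OF i_lin] and p_cl = lin_map_closed[OF p_lin]
  \<comment> \<open>Merely a choice of preimages, with no linearity; \<open>s\<close> is the linear
    section obtained from it.\<close>
  define g where "g = inv_into (carrier M) p"
  have g: "g x \<in> carrier M" "p (g x) = x" if "x \<in> carrier M2" for x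
    unfolding g_def using that p_surj by (auto intro: inv_into_into f_inv_into_f)
  define s where "s n = msum M (map (\<lambda>(e, \<phi>). \<phi> n \<odot>\<^bsub>M\<^esub> g e) B2)" for n
  have s_lin: "lin_map K M2 M s"
    unfolding s_def using lin_map_section[OF M_mod M2_mod B2, of g] g mem2 by blast
  note s_cl = lin_map_closed[OF s_lin]
  have ps: "p (s n) = n" if n: "n \<in> carrier M2" for n
  proof -
    have "p (s n) = msum M2 (map p (map (\<lambda>(e, \<phi>). \<phi> n \<odot>\<^bsub>M\<^esub> g e) B2))"
      unfolding s_def using mem2 g n
      by (intro lin_map_msum[OF M_mod M2_mod p_lin]) (auto simp: lin_functional_closed[OF mem2(2)])
    also have "map p (map (\<lambda>(e, \<phi>). \<phi> n \<odot>\<^bsub>M\<^esub> g e) B2) = map (\<lambda>(e, \<phi>). \<phi> n \<odot>\<^bsub>M2\<^esub> e) B2"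
      using mem2 g n p_lin lin_functional_closed[OF mem2(2)] by (auto simp: lin_map_def)
    finally show ?thesis using dual_basis_expand[OF B2 n] by simp
  qed
  \<comment> \<open>The projection \<open>id - s \<circ> p\<close> onto the kernel of
    \<open>p\<close>; through exactness it lifts along \<open>i\<close> to the retraction
    \<open>r\<close>.\<close>
  define q where "q m = m \<oplus>\<^bsub>M\<^esub> (\<ominus>\<^bsub>K\<^esub> \<one>\<^bsub>K\<^esub>) \<odot>\<^bsub>M\<^esub> s (p m)" for m
  have q_lin: "lin_map K M M q"
    unfolding lin_map_def
  proof (intro conjI ballI)
    show "q \<in> carrier M \<rightarrow> carrier M" using s_cl p_cl by (auto simp: q_def)
  next
    fix x y assume xy: "x \<in> carrier M" "y \<in> carrier M"
    then have "s (p (x \<oplus>\<^bsub>M\<^esub> y)) = s (p x) \<oplus>\<^bsub>M\<^esub> s (p y)"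
      using p_lin s_lin p_cl by (simp add: lin_map_def)
    then show "q (x \<oplus>\<^bsub>M\<^esub> y) = q x \<oplus>\<^bsub>M\<^esub> q y"
      using xy s_cl p_cl by (simp add: q_def M.smult_r_distr M.M.a_ac)
  next
    fix r x assume rx: "r \<in> carrier K" "x \<in> carrier M"
    then have "s (p (r \<odot>\<^bsub>M\<^esub> x)) = r \<odot>\<^bsub>M\<^esub> s (p x)"
      using p_lin s_lin p_cl by (simp add: lin_map_def)
    moreover have "(\<ominus>\<^bsub>K\<^esub> \<one>\<^bsub>K\<^esub>) \<odot>\<^bsub>M\<^esub> (r \<odot>\<^bsub>M\<^esub> s (p x)) = r \<odot>\<^bsub>M\<^esub> ((\<ominus>\<^bsub>K\<^esub> \<one>\<^bsub>K\<^esub>) \<odot>\<^bsub>M\<^esub> s (p x))"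
      using rx s_cl p_cl by (simp add: M.smult_l_minus M.smult_r_minus)
    ultimately show "q (r \<odot>\<^bsub>M\<^esub> x) = r \<odot>\<^bsub>M\<^esub> q x"
      using rx s_cl p_cl by (simp add: q_def M.smult_r_distr)
  qed
  have q_im: "q ` carrier M \<subseteq> i ` carrier M1"
    unfolding exact
  proof clarify
    fix m assume m: "m \<in> carrier M"
    have "p (q m) = p m \<oplus>\<^bsub>M2\<^esub> (\<ominus>\<^bsub>K\<^esub> \<one>\<^bsub>K\<^esub>) \<odot>\<^bsub>M2\<^esub> p (s (p m))"
      using p_lin m s_cl p_cl by (simp add: q_def lin_map_def)
    also have "\<dots> = \<zero>\<^bsub>M2\<^esub>"
      using ps p_cl m by (simp add: M2.smult_l_minus M2.M.r_neg)
    finally show "q m \<in> carrier M \<and> p (q m) = \<zero>\<^bsub>M2\<^esub>"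
      using lin_map_closed[OF q_lin m] by simp
  qed
  define r where "r m = inv_into (carrier M1) i (q m)" for m
  have r_lin: "lin_map K M M1 r"
    unfolding r_def by (rule lin_map_left_inverse[OF M1_mod M_mod M_mod i_lin i_inj q_lin q_im])
  note r_cl = lin_map_closed[OF r_lin]
  have ir: "i (r m) = q m" if "m \<in> carrier M" for m
    unfolding r_def using f_inv_into_f[of "q m" i "carrier M1"] q_im that by auto
  have pi: "p (i x) = \<zero>\<^bsub>M2\<^esub>" if "x \<in> carrier M1" for x
    using exact that by auto
  have ri: "r (i x) = x" if "x \<in> carrier M1" for x
  proof -
    have "q (i x) = i x"
      using pi[OF that] lin_map_zero[OF M2_mod M_mod s_lin] i_cl[OF that] by (simp add: q_def)
    then show ?thesis using i_inj that by (simp add: r_def)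
  qed
  \<comment> \<open>The second block keeps the preimages \<open>g e\<close> rather than
    \<open>s e\<close>: the functionals \<open>\<phi> \<circ> p\<close> paired with
    \<open>g e\<close> sum to \<open>s (p m)\<close> by definition, which complements
    \<open>i (r m) = q m\<close>.\<close>
  let ?B1 = "map (\<lambda>(e, \<phi>). (i e, \<phi> \<circ> r)) B1" and ?B2 = "map (\<lambda>(e, \<phi>). (g e, \<phi> \<circ> p)) B2"
  have B: "dual_basis K M (?B1 @ ?B2)"
    unfolding dual_basis_def
  proof (intro conjI ballI)
    fix x assume "x \<in> set (?B1 @ ?B2)"
    then show "case x of (e, \<phi>) \<Rightarrow> e \<in> carrier M \<and> lin_functional K M \<phi>"
      using i_cl g mem1 mem2 lin_functional_comp[OF r_lin] lin_functional_comp[OF p_lin] by auto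
  next
    fix m assume m: "m \<in> carrier M"
    let ?f = "\<lambda>(e, \<phi>). \<phi> m \<odot>\<^bsub>M\<^esub> e"
    have "set (map ?f ?B1) \<subseteq> carrier M"
      using i_cl mem1 r_cl m by (auto simp: lin_functional_closed[OF mem1(2)])
    moreover have "set (map ?f ?B2) \<subseteq> carrier M"
      using g mem2 p_cl m by (auto simp: lin_functional_closed[OF mem2(2)])
    ultimately have "msum M (map ?f (?B1 @ ?B2)) = msum M (map ?f ?B1) \<oplus>\<^bsub>M\<^esub> msum M (map ?f ?B2)"
      unfolding map_append by (rule msum_append[OF M_mod])
    also have "msum M (map ?f ?B1) = i (r m)"
      using dual_basis_pushforward[OF M1_mod M_mod B1 i_lin r_cl[OF m]] by (simp add: comp_def case_prod_unfold)
    also have "msum M (map ?f ?B2) = s (p m)"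
      by (simp add: s_def comp_def case_prod_unfold)
    also have "i (r m) \<oplus>\<^bsub>M\<^esub> s (p m) = m"
      using m s_cl[OF p_cl[OF m]] by (simp add: ir q_def M.smult_l_minus M.M.a_assoc M.M.l_neg)
    finally show "m = msum M (map ?f (?B1 @ ?B2))" ..
  qed
  \<comment> \<open>Only the diagonal coefficients matter. The maps \<open>r\<close> and
    \<open>s\<close> are merely linear; colinearity of \<open>i\<close> pulls the functional back to
    \<open>\<phi> \<circ> r \<circ> i\<close>, which agrees with \<open>\<phi>\<close> on
    \<open>M1\<close>.\<close>
  have 1: "mcoeff C \<rho> (\<phi> \<circ> r) (i e) = mcoeff C \<rho>1 \<phi> e" if "(e, \<phi>) \<in> set B1" for e \<phi>
  proof -
    note e = mem1[OF that]
    have "mcoeff C \<rho> (\<phi> \<circ> r) (i e) = mcoeff C \<rho>1 (\<phi> \<circ> r \<circ> i) e"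
      by (rule comod_hom_mcoeff[OF C M i lin_functional_comp[OF r_lin e(2)] e(1)])
    also have "\<dots> = mcoeff C \<rho>1 \<phi> e"
      unfolding mcoeff_def using comodule_mem[OF M1 e(1)] ri
      by (intro arg_cong[of _ _ "msum C"] map_cong) auto
    finally show ?thesis .
  qed
  \<comment> \<open>Here colinearity of \<open>p\<close> moves the coefficient down to
    \<open>M2\<close>, where \<open>g e\<close> becomes \<open>e\<close>.\<close>
  have 2: "mcoeff C \<rho> (\<phi> \<circ> p) (g e) = mcoeff C \<rho>2 \<phi> e" if "(e, \<phi>) \<in> set B2" for e \<phi>
    using comod_hom_mcoeff[OF C M2 p mem2(2)[OF that] g(1)[OF mem2(1)[OF that]]]
      g(2)[OF mem2(1)[OF that]] by simp
  have "map (\<lambda>(e, \<phi>). mcoeff C \<rho> \<phi> e) (?B1 @ ?B2)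
      = map (\<lambda>(e, \<phi>). mcoeff C \<rho>1 \<phi> e) B1 @ map (\<lambda>(e, \<phi>). mcoeff C \<rho>2 \<phi> e) B2"
    using 1 2 by auto
  moreover have "set (map (\<lambda>(e, \<phi>). mcoeff C \<rho>1 \<phi> e) B1) \<subseteq> carrier C"
      "set (map (\<lambda>(e, \<phi>). mcoeff C \<rho>2 \<phi> e) B2) \<subseteq> carrier C"
    using mcoeff_closed[OF C M1] mcoeff_closed[OF C M2] mem1 mem2 by auto
  ultimately show ?thesis
    unfolding comod_rank_eq[OF C M B] comod_rank_eq[OF C M1 B1] comod_rank_eq[OF C M2 B2]
    by (simp only: msum_append[OF C])
qed

section \<open>Descent of the rank to the Grothendieck group\<close>

lemma comod_iso_refl:
  "comod_iso K C M \<rho> M \<rho>"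
  unfolding comod_iso_def comod_hom_def lin_map_def
  by (intro exI[of _ id]) (auto intro: tens_eq.refl)

text \<open>Isomorphism invariance defines the rank on generators, the universal property of the
  free abelian group extends it, and additivity puts the relations into the kernel, so it factors
  through the quotient.\<close>

theorem theorem2p23:
  fixes K :: "'k ring" and C :: "('k, 'c) module"
    and \<Delta> :: "'c \<Rightarrow> ('c \<times> 'c) list" and \<epsilon> :: "'c \<Rightarrow> 'k"
  assumes "fin_prod_fields K"
    and "coalgebra K C \<Delta> \<epsilon>"
  shows "\<exists>\<Phi>. \<Phi> \<in> hom (K0 K C \<Delta> \<epsilon> :: ((('k, 'm) module \<times> ('m \<Rightarrow> ('m \<times> 'c) list)) set \<Rightarrow>\<^sub>0 int) set monoid)
                     (add_monoid C) \<and>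
             \<Phi> ` carrier (K0 K C \<Delta> \<epsilon> :: ((('k, 'm) module \<times> ('m \<Rightarrow> ('m \<times> 'c) list)) set \<Rightarrow>\<^sub>0 int) set monoid)
               \<subseteq> coHH0 K C \<Delta> \<and>
             (\<forall>Ma \<in> (fg_comods K C \<Delta> \<epsilon> :: (('k, 'm) module \<times> ('m \<Rightarrow> ('m \<times> 'c) list)) set).
                \<Phi> (K0_class K C \<Delta> \<epsilon> Ma) = comod_rank K C (fst Ma) (snd Ma))"
proof -
  note C = assms(2) and C_mod = coalgebra_module[OF assms(2)]
  interpret C: module K C by (rule C_mod)
  define fg where "fg = (fg_comods K C \<Delta> \<epsilon> :: (('k, 'm) module \<times> ('m \<Rightarrow> ('m \<times> 'c) list)) set)"
  define S where "S = (K0_gens K C \<Delta> \<epsilon> :: (('k, 'm) module \<times> ('m \<Rightarrow> ('m \<times> 'c) list)) set set)"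
  define R where "R = (K0_rels K C \<Delta> \<epsilon> :: ((('k, 'm) module \<times> ('m \<Rightarrow> ('m \<times> 'c) list)) set \<Rightarrow>\<^sub>0 int) set)"
  define cls where "cls = (comod_class K C \<Delta> \<epsilon> :: (('k, 'm) module \<times> ('m \<Rightarrow> ('m \<times> 'c) list)) \<Rightarrow> _)"
  define rk where "rk Ma = comod_rank K C (fst Ma) (snd Ma)" for Ma :: "('k, 'm) module \<times> ('m \<Rightarrow> ('m \<times> 'c) list)"
  have S: "S = cls ` fg" by (simp add: S_def K0_gens_def cls_def fg_def)
  have comod: "comodule K C \<Delta> \<epsilon> M \<rho>" "\<exists>B. dual_basis K M B" if "(M, \<rho>) \<in> fg" for M \<rho>
    using that dual_basis_exists[OF assms(1) comodule_module] by (auto simp: fg_def fg_comods_def)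
  have rk_coHH0: "rk Ma \<in> coHH0 K C \<Delta>" if "Ma \<in> fg" for Ma
    using comod[of "fst Ma" "snd Ma"] that comod_rank_in_coHH0[OF C] by (auto simp: rk_def)
  \<comment> \<open>Reflexivity makes the class inhabited; whichever member the choice returns is
    the target of an isomorphism from \<open>Ma\<close>, hence has the same rank.\<close>
  have rk_cls: "rk (SOME Nb. Nb \<in> cls Ma) = rk Ma" if Ma: "Ma \<in> fg" for Ma
  proof -
    have "Ma \<in> cls Ma" using Ma by (simp add: cls_def comod_class_def fg_def comod_iso_refl)
    then have "(SOME Nb. Nb \<in> cls Ma) \<in> cls Ma" by (rule someI)
    then have Nb: "(SOME Nb. Nb \<in> cls Ma) \<in> fg"
        "comod_iso K C (fst Ma) (snd Ma) (fst (SOME Nb. Nb \<in> cls Ma)) (snd (SOME Nb. Nb \<in> cls Ma))"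
      by (simp_all add: cls_def comod_class_def fg_def)
    obtain B where "dual_basis K (fst Ma) B" using comod(2)[of "fst Ma" "snd Ma"] Ma by auto
    then show ?thesis
      unfolding rk_def using Nb Ma
      by (intro comod_rank_iso[OF C_mod comod(1) comod(1) _ Nb(2)]) auto
  qed
  define rkc where "rkc Q = rk (SOME Nb. Nb \<in> Q)" for Q
  let ?H = "(add_monoid C)\<lparr>carrier := coHH0 K C \<Delta>\<rparr>"
  let ?F = "free_Abelian_group S"
  have sub: "subgroup (coHH0 K C \<Delta>) (add_monoid C)" by (rule subgroup_coHH0[OF C])
  interpret H: comm_group ?H
    by (rule group.group_comm_groupI[OF group.subgroup_imp_group[OF C.M.a_group sub]])
      (auto simp: coHH0_def C.M.a_comm)
  interpret F: comm_group ?F by (rule abelian_free_Abelian_group)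
  have "rkc ` S \<subseteq> coHH0 K C \<Delta>"
    using rk_coHH0 rk_cls by (auto simp: S rkc_def)
  then obtain h where h: "h \<in> hom ?F ?H" and h_frag: "\<And>Q. Q \<in> S \<Longrightarrow> h (frag_of Q) = rkc Q"
    using H.free_Abelian_group_universal[of rkc S] by auto
  interpret h: group_hom ?F ?H h
    by (intro group_hom.intro group_hom_axioms.intro h F.group_axioms H.group_axioms)
  have h_cls: "h (frag_of (cls Ma)) = rk Ma" if "Ma \<in> fg" for Ma
    using h_frag[of "cls Ma"] rk_cls[OF that] that by (simp add: S rkc_def)
  \<comment> \<open>The relations use subtraction of finitely supported functions, whereas a
    homomorphism only speaks of the group operation; the value is solved from
    \<open>h(x - y) + h(y) = h(x)\<close>.\<close>
  have h_diff: "h (x - y) = h x \<ominus>\<^bsub>C\<^esub> h y" if "x \<in> carrier ?F" "y \<in> carrier ?F" for x y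
  proof -
    have "x - y \<in> carrier ?F"
      using F.m_closed[OF that(1) F.inv_closed[OF that(2)]] that by simp
    then have "h (x - y) \<oplus>\<^bsub>C\<^esub> h y = h x"
      using h.hom_mult[of "x - y" y] that(2) by simp
    moreover have "h (x - y) \<in> carrier C" "h y \<in> carrier C"
      using h.hom_closed[OF \<open>x - y \<in> carrier ?F\<close>] h.hom_closed[OF that(2)] by (auto simp: coHH0_def)
    ultimately show ?thesis
      by (metis C.M.add.inv_solve_right' C.M.minus_eq C.M.a_closed)
  qed
  have R_ker: "R \<subseteq> kernel ?F ?H h"
  proof
    fix x assume "x \<in> R"
    then obtain M \<rho> M1 \<rho>1 M2 \<rho>2 where x: "x = frag_of (cls (M, \<rho>)) - frag_of (cls (M1, \<rho>1)) - frag_of (cls (M2, \<rho>2))"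
      and fg: "(M, \<rho>) \<in> fg" "(M1, \<rho>1) \<in> fg" "(M2, \<rho>2) \<in> fg" and ses: "comod_ses K C M1 \<rho>1 M \<rho> M2 \<rho>2"
      unfolding R_def K0_rels_def cls_def fg_def by blast
    have mem: "frag_of (cls Ma) \<in> carrier ?F" if "Ma \<in> fg" for Ma
      using that by (simp add: S)
    have mem': "frag_of (cls (M, \<rho>)) - frag_of (cls (M1, \<rho>1)) \<in> carrier ?F"
      using F.m_closed[OF mem[OF fg(1)] F.inv_closed[OF mem[OF fg(2)]]] fg by (simp add: S)
    have "x \<in> carrier ?F"
      unfolding x using F.m_closed[OF mem' F.inv_closed[OF mem[OF fg(3)]]] fg by (simp add: S)
    moreover have "h x = \<zero>\<^bsub>C\<^esub>"
    proof -
      obtain B1 B2 where B: "dual_basis K M1 B1" "dual_basis K M2 B2" using comod(2) fg by meson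
      have cl: "rk Ma \<in> carrier C" if "Ma \<in> fg" for Ma using rk_coHH0[OF that] by (simp add: coHH0_def)
      have "rk (M, \<rho>) = rk (M1, \<rho>1) \<oplus>\<^bsub>C\<^esub> rk (M2, \<rho>2)"
        unfolding rk_def using comod_rank_ses[OF C_mod comod(1) comod(1) comod(1) B ses] fg by simp
      moreover have "a \<oplus>\<^bsub>C\<^esub> b \<ominus>\<^bsub>C\<^esub> a \<ominus>\<^bsub>C\<^esub> b = \<zero>\<^bsub>C\<^esub>" if "a \<in> carrier C" "b \<in> carrier C" for a b
      proof -
        have "a \<oplus>\<^bsub>C\<^esub> b \<ominus>\<^bsub>C\<^esub> a \<ominus>\<^bsub>C\<^esub> b = (a \<oplus>\<^bsub>C\<^esub> b) \<oplus>\<^bsub>C\<^esub> \<ominus>\<^bsub>C\<^esub> (a \<oplus>\<^bsub>C\<^esub> b)"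
          using that by (simp add: C.M.minus_eq C.M.minus_add C.M.a_assoc)
        then show ?thesis using that by (simp add: C.M.r_neg)
      qed
      moreover have "h x = rk (M, \<rho>) \<ominus>\<^bsub>C\<^esub> rk (M1, \<rho>1) \<ominus>\<^bsub>C\<^esub> rk (M2, \<rho>2)"
        unfolding x h_diff[OF mem' mem[OF fg(3)]] h_diff[OF mem[OF fg(1)] mem[OF fg(2)]]
        using h_cls fg by simp
      ultimately show ?thesis
        using cl fg by simp
    qed
    ultimately show "x \<in> kernel ?F ?H h" by (simp add: kernel_def)
  qed
  then have R_sub: "R \<subseteq> carrier ?F" by (auto simp: kernel_def)
  have "generate ?F R \<subseteq> kernel ?F ?H h"
    by (rule F.generate_subgroup_incl[OF R_ker h.subgroup_kernel])
  moreover have "generate ?F R \<lhd> ?F"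
    by (intro F.subgroup_imp_normal F.generate_is_subgroup R_sub)
  ultimately obtain \<Phi> where \<Phi>: "\<Phi> \<in> hom (?F Mod generate ?F R) ?H"
    and \<Phi>_coset: "\<And>x. x \<in> carrier ?F \<Longrightarrow> \<Phi> (generate ?F R #>\<^bsub>?F\<^esub> x) = h x"
    using h.FactGroup_universal_kernel by blast
  have K0: "K0 K C \<Delta> \<epsilon> = ?F Mod generate ?F R" by (simp add: K0_def S_def R_def)
  show ?thesis
    unfolding K0
  proof (intro exI[of _ \<Phi>] conjI ballI)
    show "\<Phi> \<in> hom (?F Mod generate ?F R) (add_monoid C)"
      using \<Phi> by (auto simp: hom_def coHH0_def Pi_def)
    show "\<Phi> ` carrier (?F Mod generate ?F R) \<subseteq> coHH0 K C \<Delta>"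
      using \<Phi> by (auto simp: hom_def)
  next
    fix Ma :: "('k, 'm) module \<times> ('m \<Rightarrow> ('m \<times> 'c) list)"
    assume Ma: "Ma \<in> fg_comods K C \<Delta> \<epsilon>"
    then have "Ma \<in> fg" by (simp add: fg_def)
    then have "\<Phi> (generate ?F R #>\<^bsub>?F\<^esub> frag_of (cls Ma)) = rk Ma"
      using \<Phi>_coset[of "frag_of (cls Ma)"] h_cls by (simp add: S)
    then show "\<Phi> (K0_class K C \<Delta> \<epsilon> Ma) = comod_rank K C (fst Ma) (snd Ma)"
      by (simp add: K0_class_def S_def R_def cls_def rk_def)
  qed
qed

end
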